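(* Let $\mathcal{C}\leq RG$ be a relative projective group code over $R$ with corresponding chain $$\mathcal{C}_\star: C_0\leq C_1\leq\dots\leq C_{\ell-1}.$$ Then the corresponding chain for the dual code $\mathcal{C}^\perp$ is given by $$\mathcal{C}^\perp_\star: C_{\ell-1}^\perp\leq\dots\leq C_1^\perp\leq C_0^\perp ,$$ i.e. $(\mathcal{C}^\perp)_j=(C_{\ell-1-j})^\perp$ for all $0\le j\le \ell-1$.
   Context: $R$ is a commutative Artinian chain ring with $1$, with maximal ideal $\mathfrak{m}=\pi R$ ($\pi$ a fixed generator) and residue field $\mathbb{F}=R/\mathfrak{m}$, a finite field of characteristic $p$. $\ell$ is the length of $R$, i.e. the minimal natural number with $\mathfrak{m}^\ell=\{0\}$. $G$ is a finite group; $RG$ and $\mathbb{F}G$ are the group rings. For $j=0,\dots,\ell-1$ let $\alpha_j:\mathfrak{m}^jRG/\mathfrak{m}^{j+1}RG\to\mathbb{F}G$ be the $R$-module isomorphism given coefficientwise by $\pi^jr+\mathfrak{m}^{j+1}\mapsto r+\mathfrak{m}$. A group code over $R$ (resp. $\mathbb{F}$) is a left ideal in $RG$ (resp. $\mathbb{F}G$). A group code $\mathcal{C}\leq RG$ is called relative projective if it is relative projective for the subgroup $\{1\}$ of $G$, i.e. for any short exact sequence $0\to\mathcal{M}\to\mathcal{N}\xrightarrow{\varphi}\mathcal{C}\to 0$ of (left) $RG$-modules for which there is an $R$-module homomorphism $\psi:\mathcal{C}\to\mathcal{N}$ with $\varphi\circ\psi=\mathrm{id}_{\mathcal{C}}$,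 there is an $RG$-module homomorphism $\psi':\mathcal{C}\to\mathcal{N}$ with $\varphi\circ\psi'=\mathrm{id}_{\mathcal{C}}$. The chain $\mathcal{C}_\star$ corresponding to a group code $\mathcal{C}\leq RG$ consists of the codes $$C_j:=(\mathcal{C})_j:=\alpha_j\left(\frac{\mathcal{C}\cap\mathfrak{m}^jRG}{\mathcal{C}\cap\mathfrak{m}^{j+1}RG}\right)\leq\mathbb{F}G,\qquad 0\le j\le\ell-1,$$ where the quotient is regarded as a submodule of $\mathfrak{m}^jRG/\mathfrak{m}^{j+1}RG$. For $A=\mathbb{F}$ or $A=R$, the bilinear form on $AG$ is $\left(\sum_{g}a_gg,\sum_gb_gg\right)=\sum_{g\in G}a_gb_g\in A$, and the dual of a group code $C\leq AG$ is $C^\perp=\{v\in AG\mid (c,v)=0\text{ for all }c\in C\}$. *)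

theory Defs
  imports "HOL-Algebra.Module" "HOL-Algebra.QuotRing" "HOL-Algebra.Ideal_Product"
    "HOL-Algebra.Generated_Groups"
begin

section \<open>Artinian chain rings\<close>

locale artinian_chain_ring = cring R for R (structure) +
  assumes chain: "\<lbrakk>ideal I R; ideal J R\<rbrakk> \<Longrightarrow> I \<subseteq> J \<or> J \<subseteq> I"
    and descending_chain_condition:
      "\<lbrakk>\<And>n::nat. ideal (D n) R; \<And>n. D (Suc n) \<subseteq> D n\<rbrakk> \<Longrightarrow> \<exists>n. \<forall>k\<ge>n. D k = D n"

definition ideal_power :: "('a, 'b) ring_scheme \<Rightarrow> 'a set \<Rightarrow> nat \<Rightarrow> 'a set"
  where "ideal_power R I n = I [^]\<^bsub>ideals_set R\<^esub> n"

text \<open>The least index exists when \<open>m\<close> is the maximal ideal of an Artinian chain ring,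
  because \<open>m\<close> is then nilpotent.\<close>

definition chain_ring_length :: "('a, 'b) ring_scheme \<Rightarrow> 'a set \<Rightarrow> nat"
  where "chain_ring_length R m = (LEAST n. ideal_power R m n = {\<zero>\<^bsub>R\<^esub>})"

definition has_characteristic :: "('a, 'b) ring_scheme \<Rightarrow> nat \<Rightarrow> bool"
  where "has_characteristic A p \<longleftrightarrow> (\<forall>n::nat. [n] \<cdot>\<^bsub>A\<^esub> \<one>\<^bsub>A\<^esub> = \<zero>\<^bsub>A\<^esub> \<longleftrightarrow> p dvd n)"


section \<open>Modules over not necessarily commutative rings\<close>

text \<open>The locale \<^locale>\<open>module\<close> of the library asks for a commutative ring of scalars, so it
  does not apply to group rings. The record type is the same; its multiplicative fields
  play no role for modules.\<close>

locale left_module = A?: ring A + M?: abelian_group M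
  for A :: "('a, 'b) ring_scheme" and M :: "('a, 'm, 'c) module_scheme" (structure) +
  assumes smult_closed: "\<lbrakk>a \<in> carrier A; x \<in> carrier M\<rbrakk> \<Longrightarrow> a \<odot> x \<in> carrier M"
    and smult_l_distr: "\<lbrakk>a \<in> carrier A; b \<in> carrier A; x \<in> carrier M\<rbrakk>
      \<Longrightarrow> (a \<oplus>\<^bsub>A\<^esub> b) \<odot> x = a \<odot> x \<oplus> b \<odot> x"
    and smult_r_distr: "\<lbrakk>a \<in> carrier A; x \<in> carrier M; y \<in> carrier M\<rbrakk>
      \<Longrightarrow> a \<odot> (x \<oplus> y) = a \<odot> x \<oplus> a \<odot> y"
    and smult_assoc: "\<lbrakk>a \<in> carrier A; b \<in> carrier A; x \<in> carrier M\<rbrakk>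
      \<Longrightarrow> (a \<otimes>\<^bsub>A\<^esub> b) \<odot> x = a \<odot> (b \<odot> x)"
    and smult_one: "x \<in> carrier M \<Longrightarrow> \<one>\<^bsub>A\<^esub> \<odot> x = x"

definition module_hom ::
    "('a, 'b) ring_scheme \<Rightarrow> ('a, 'm, 'c) module_scheme \<Rightarrow> ('a, 'n, 'd) module_scheme
      \<Rightarrow> ('m \<Rightarrow> 'n) set"
  where "module_hom A M N = {f. f \<in> carrier M \<rightarrow> carrier N
    \<and> (\<forall>x\<in>carrier M. \<forall>y\<in>carrier M. f (x \<oplus>\<^bsub>M\<^esub> y) = f x \<oplus>\<^bsub>N\<^esub> f y)
    \<and> (\<forall>a\<in>carrier A. \<forall>x\<in>carrier M. f (a \<odot>\<^bsub>M\<^esub> x) = a \<odot>\<^bsub>N\<^esub> f x)}"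

definition short_exact_modules ::
    "('a, 'b) ring_scheme \<Rightarrow> ('a, 'k) module \<Rightarrow> ('k \<Rightarrow> 'n) \<Rightarrow> ('a, 'n) module
      \<Rightarrow> ('n \<Rightarrow> 'm) \<Rightarrow> ('a, 'm) module \<Rightarrow> bool"
  where "short_exact_modules A K \<iota> N \<phi> M \<longleftrightarrow>
    left_module A K \<and> left_module A N \<and> left_module A M
    \<and> \<iota> \<in> module_hom A K N \<and> \<phi> \<in> module_hom A N M
    \<and> inj_on \<iota> (carrier K)
    \<and> \<iota> ` carrier K = {x \<in> carrier N. \<phi> x = \<zero>\<^bsub>M\<^esub>}
    \<and> \<phi> ` carrier N = carrier M"

definition restrict_scalars :: "('a \<Rightarrow> 'b) \<Rightarrow> ('b, 'm) module \<Rightarrow> ('a, 'm) module"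
  where "restrict_scalars f M = \<lparr>carrier = carrier M, mult = mult M, one = one M,
    zero = zero M, add = add M, smult = (\<lambda>r. smult M (f r))\<rparr>"

text \<open>\<open>I M\<close>, the additive subgroup generated by the products of elements of \<open>I\<close> and \<open>M\<close>.\<close>

definition ideal_smult :: "'a set \<Rightarrow> ('a, 'm) module \<Rightarrow> 'm set"
  where "ideal_smult I M = generate (add_monoid M) {a \<odot>\<^bsub>M\<^esub> x | a x. a \<in> I \<and> x \<in> carrier M}"

locale left_ideal = additive_subgroup I A + ring A for I and A (structure) +
  assumes l_closed: "\<lbrakk>a \<in> I; x \<in> carrier A\<rbrakk> \<Longrightarrow> x \<otimes> a \<in> I"

definition left_ideal_module :: "('a, 'b) ring_scheme \<Rightarrow> 'a set \<Rightarrow> ('a, 'a) module"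
  where "left_ideal_module A I = \<lparr>carrier = I, mult = mult A, one = one A,
    zero = zero A, add = add A, smult = mult A\<rparr>"


section \<open>Group rings and group codes\<close>

definition group_ring ::
    "('a, 'b) ring_scheme \<Rightarrow> ('g, 'c) monoid_scheme \<Rightarrow> ('a, 'g \<Rightarrow> 'a) module"
  where "group_ring A G = \<lparr>
    carrier = carrier G \<rightarrow>\<^sub>E carrier A,
    mult = (\<lambda>a b. \<lambda>g\<in>carrier G. \<Oplus>\<^bsub>A\<^esub>h\<in>carrier G. a h \<otimes>\<^bsub>A\<^esub> b (inv\<^bsub>G\<^esub> h \<otimes>\<^bsub>G\<^esub> g)),
    one = (\<lambda>g\<in>carrier G. if g = \<one>\<^bsub>G\<^esub> then \<one>\<^bsub>A\<^esub> else \<zero>\<^bsub>A\<^esub>),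
    zero = (\<lambda>g\<in>carrier G. \<zero>\<^bsub>A\<^esub>),
    add = (\<lambda>a b. \<lambda>g\<in>carrier G. a g \<oplus>\<^bsub>A\<^esub> b g),
    smult = (\<lambda>r a. \<lambda>g\<in>carrier G. r \<otimes>\<^bsub>A\<^esub> a g)\<rparr>"

definition group_code ::
    "('a, 'b) ring_scheme \<Rightarrow> ('g, 'c) monoid_scheme \<Rightarrow> ('g \<Rightarrow> 'a) set \<Rightarrow> bool"
  where "group_code A G C \<longleftrightarrow> left_ideal C (group_ring A G)"

definition code_form ::
    "('a, 'b) ring_scheme \<Rightarrow> ('g, 'c) monoid_scheme \<Rightarrow> ('g \<Rightarrow> 'a) \<Rightarrow> ('g \<Rightarrow> 'a) \<Rightarrow> 'a"
  where "code_form A G a b = (\<Oplus>\<^bsub>A\<^esub>g\<in>carrier G. a g \<otimes>\<^bsub>A\<^esub> b g)"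

definition dual_code ::
    "('a, 'b) ring_scheme \<Rightarrow> ('g, 'c) monoid_scheme \<Rightarrow> ('g \<Rightarrow> 'a) set \<Rightarrow> ('g \<Rightarrow> 'a) set"
  where "dual_code A G C =
    {v \<in> carrier (group_ring A G). \<forall>c\<in>C. code_form A G c v = \<zero>\<^bsub>A\<^esub>}"

definition scalar_embedding ::
    "('a, 'b) ring_scheme \<Rightarrow> ('g, 'c) monoid_scheme \<Rightarrow> 'a \<Rightarrow> 'g \<Rightarrow> 'a"
  where "scalar_embedding R G r = r \<odot>\<^bsub>group_ring R G\<^esub> \<one>\<^bsub>group_ring R G\<^esub>"

text \<open>The type \<open>'n\<close> bounds the modules \<open>K\<close> and \<open>N\<close> in the
  short exact sequences.\<close>

definition relative_projective_on ::
    "'n itself \<Rightarrow> ('a, 'b) ring_scheme \<Rightarrow> ('g, 'c) monoid_scheme \<Rightarrow> ('g \<Rightarrow> 'a) set \<Rightarrow> bool"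
  where "relative_projective_on _ R G C \<longleftrightarrow>
    (let RG = group_ring R G;
         CM = left_ideal_module RG C
     in \<forall>(K :: ('g \<Rightarrow> 'a, 'n) module) \<iota> (N :: ('g \<Rightarrow> 'a, 'n) module) \<phi>.
          short_exact_modules RG K \<iota> N \<phi> CM \<longrightarrow>
          (\<exists>\<psi> \<in> module_hom R (restrict_scalars (scalar_embedding R G) CM)
                (restrict_scalars (scalar_embedding R G) N). \<forall>c\<in>C. \<phi> (\<psi> c) = c) \<longrightarrow>
          (\<exists>\<psi>' \<in> module_hom RG CM N. \<forall>c\<in>C. \<phi> (\<psi>' c) = c))"

text \<open>The type \<open>'g \<Rightarrow> 'g \<Rightarrow> 'a\<close> holds the induced module of \<open>C\<close> as the functions from \<open>G\<close>
  to \<open>C\<close>. This is large enough: for group codes over a commutative ring with a finite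
  group, \<open>relative_projective_universe\<close> below shows that the property then holds for
  modules over every type.\<close>

definition relative_projective ::
    "('a, 'b) ring_scheme \<Rightarrow> ('g, 'c) monoid_scheme \<Rightarrow> ('g \<Rightarrow> 'a) set \<Rightarrow> bool"
  where "relative_projective (R :: ('a, 'b) ring_scheme) (G :: ('g, 'c) monoid_scheme) C \<longleftrightarrow>
    relative_projective_on TYPE('g \<Rightarrow> 'g \<Rightarrow> 'a) R G C"


section \<open>The chain of a group code\<close>

abbreviation filtration ::
    "('a, 'b) ring_scheme \<Rightarrow> ('g, 'c) monoid_scheme \<Rightarrow> 'a set \<Rightarrow> nat \<Rightarrow> ('g \<Rightarrow> 'a) set"
  where "filtration R G m j \<equiv> ideal_smult (ideal_power R m j) (group_ring R G)"

text \<open>The map \<open>m\<^sup>j / m\<^sup>j\<^sup>+\<^sup>1 \<rightarrow> R / m\<close> sending \<open>\<pi>\<^sup>j r + m\<^sup>j\<^sup>+\<^sup>1\<close> to \<open>r + m\<close>. The value is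
  uniquely determined as long as \<open>j\<close> is less than the length of \<open>R\<close>.\<close>

definition coefficient_iso ::
    "('a, 'b) ring_scheme \<Rightarrow> 'a set \<Rightarrow> 'a \<Rightarrow> nat \<Rightarrow> 'a set \<Rightarrow> 'a set"
  where "coefficient_iso R m \<pi> j X = (THE y. \<exists>r\<in>carrier R.
    X = ideal_power R m (Suc j) +>\<^bsub>R\<^esub> (\<pi> [^]\<^bsub>R\<^esub> j \<otimes>\<^bsub>R\<^esub> r) \<and> y = m +>\<^bsub>R\<^esub> r)"

text \<open>For a coset \<open>V = v + m\<^sup>j\<^sup>+\<^sup>1 RG\<close>, the set of all \<open>w g\<close> with \<open>w \<in> V\<close> is the coset
  \<open>v g + m\<^sup>j\<^sup>+\<^sup>1\<close>, that is, the coefficient of \<open>V\<close> at \<open>g\<close>.\<close>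

definition alpha ::
    "('a, 'b) ring_scheme \<Rightarrow> ('g, 'c) monoid_scheme \<Rightarrow> 'a set \<Rightarrow> 'a \<Rightarrow> nat
      \<Rightarrow> ('g \<Rightarrow> 'a) set \<Rightarrow> 'g \<Rightarrow> 'a set"
  where "alpha R G m \<pi> j V = (\<lambda>g\<in>carrier G. coefficient_iso R m \<pi> j ((\<lambda>w. w g) ` V))"

text \<open>The quotient of \<open>C \<inter> m\<^sup>j RG\<close> by \<open>C \<inter> m\<^sup>j\<^sup>+\<^sup>1 RG\<close>, regarded as a submodule of
  \<open>m\<^sup>j RG / m\<^sup>j\<^sup>+\<^sup>1 RG\<close>, consists of the cosets \<open>c + m\<^sup>j\<^sup>+\<^sup>1 RG\<close> with \<open>c \<in> C \<inter> m\<^sup>j RG\<close>.\<close>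

definition code_chain ::
    "('a, 'b) ring_scheme \<Rightarrow> ('g, 'c) monoid_scheme \<Rightarrow> 'a set \<Rightarrow> 'a \<Rightarrow> ('g \<Rightarrow> 'a) set
      \<Rightarrow> nat \<Rightarrow> ('g \<Rightarrow> 'a set) set"
  where "code_chain R G m \<pi> C j = alpha R G m \<pi> j `
    (\<lambda>c. filtration R G m (Suc j) +>\<^bsub>group_ring R G\<^esub> c) ` (C \<inter> filtration R G m j)"


section \<open>Dual codes are codes, and relative projectivity does not depend on the module type\<close>

lemma left_moduleI:
  fixes A :: "('a, 'b) ring_scheme" and M :: "('a, 'm, 'c) module_scheme" (structure)
  assumes "ring A" "abelian_group M"
    "\<And>a x. \<lbrakk>a \<in> carrier A; x \<in> carrier M\<rbrakk> \<Longrightarrow> a \<odot> x \<in> carrier M"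
    "\<And>a b x. \<lbrakk>a \<in> carrier A; b \<in> carrier A; x \<in> carrier M\<rbrakk>
      \<Longrightarrow> (a \<oplus>\<^bsub>A\<^esub> b) \<odot> x = a \<odot> x \<oplus> b \<odot> x"
    "\<And>a x y. \<lbrakk>a \<in> carrier A; x \<in> carrier M; y \<in> carrier M\<rbrakk>
      \<Longrightarrow> a \<odot> (x \<oplus> y) = a \<odot> x \<oplus> a \<odot> y"
    "\<And>a b x. \<lbrakk>a \<in> carrier A; b \<in> carrier A; x \<in> carrier M\<rbrakk>
      \<Longrightarrow> (a \<otimes>\<^bsub>A\<^esub> b) \<odot> x = a \<odot> (b \<odot> x)"
    "\<And>x. x \<in> carrier M \<Longrightarrow> \<one>\<^bsub>A\<^esub> \<odot> x = x"
  shows "left_module A M"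
  using assms by (intro left_module.intro left_module_axioms.intro) auto

lemma (in abelian_monoid) finsum_swap:
  assumes "finite A" "finite B" "\<And>i j. i \<in> A \<Longrightarrow> j \<in> B \<Longrightarrow> f i j \<in> carrier G"
  shows "(\<Oplus>i\<in>A. \<Oplus>j\<in>B. f i j) = (\<Oplus>j\<in>B. \<Oplus>i\<in>A. f i j)"
  using assms(1,3)
proof (induction A rule: finite_induct)
  case empty
  then show ?case by (simp add: finsum_zero)
next
  case (insert a A)
  have "(\<Oplus>i\<in>insert a A. \<Oplus>j\<in>B. f i j) = (\<Oplus>j\<in>B. f a j) \<oplus> (\<Oplus>j\<in>B. \<Oplus>i\<in>A. f i j)"
    using insert by (subst finsum_insert) (auto intro!: finsum_closed)
  also have "\<dots> = (\<Oplus>j\<in>B. f a j \<oplus> (\<Oplus>i\<in>A. f i j))"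
    using insert by (subst finsum_addf) (auto intro!: finsum_closed)
  also have "\<dots> = (\<Oplus>j\<in>B. \<Oplus>i\<in>insert a A. f i j)"
    using insert by (intro finsum_cong') (auto intro!: finsum_closed)
  finally show ?case .
qed

context left_module
begin

lemma smult_r_zero: "a \<in> carrier A \<Longrightarrow> a \<odot> \<zero> = \<zero>"
  by (metis M.add.r_cancel_one M.l_zero M.zero_closed smult_closed smult_r_distr)

lemma smult_l_zero: "x \<in> carrier M \<Longrightarrow> \<zero>\<^bsub>A\<^esub> \<odot> x = \<zero>"
  by (metis M.add.r_cancel_one A.l_zero A.zero_closed smult_closed smult_l_distr)

lemma smult_finsum_right:
  assumes "finite I" "a \<in> carrier A" "\<And>i. i \<in> I \<Longrightarrow> f i \<in> carrier M"
  shows "a \<odot> (\<Oplus>i\<in>I. f i) = (\<Oplus>i\<in>I. a \<odot> f i)"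
  using assms(1,3)
  by (induction I rule: finite_induct)
    (auto simp: smult_r_zero smult_r_distr smult_closed assms(2) Pi_def M.finsum_closed)

lemma smult_finsum_left:
  assumes "finite I" "x \<in> carrier M" "\<And>i. i \<in> I \<Longrightarrow> f i \<in> carrier A"
  shows "(\<Oplus>\<^bsub>A\<^esub>i\<in>I. f i) \<odot> x = (\<Oplus>i\<in>I. f i \<odot> x)"
  using assms(1,3)
  by (induction I rule: finite_induct)
    (auto simp: smult_l_zero smult_l_distr smult_closed assms(2) Pi_def A.finsum_closed M.finsum_closed)

end

lemma module_hom_closed: "f \<in> module_hom A M N \<Longrightarrow> x \<in> carrier M \<Longrightarrow> f x \<in> carrier N"
  and module_hom_add: "f \<in> module_hom A M N \<Longrightarrow> x \<in> carrier M \<Longrightarrow> y \<in> carrier M \<Longrightarrow>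
    f (x \<oplus>\<^bsub>M\<^esub> y) = f x \<oplus>\<^bsub>N\<^esub> f y"
  and module_hom_smult: "f \<in> module_hom A M N \<Longrightarrow> a \<in> carrier A \<Longrightarrow> x \<in> carrier M \<Longrightarrow>
    f (a \<odot>\<^bsub>M\<^esub> x) = a \<odot>\<^bsub>N\<^esub> f x"
  by (auto simp: module_hom_def)

lemma module_hom_zero:
  assumes "f \<in> module_hom A M N" "abelian_group M" "abelian_group N"
  shows "f \<zero>\<^bsub>M\<^esub> = \<zero>\<^bsub>N\<^esub>"
proof -
  interpret M: abelian_group M by fact
  interpret N: abelian_group N by fact
  show ?thesis
    using module_hom_add[OF assms(1) M.zero_closed M.zero_closed]
      module_hom_closed[OF assms(1) M.zero_closed] by (metis M.l_zero M.zero_closed N.add.r_cancel_one)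
qed

lemma module_hom_finsum:
  assumes f: "f \<in> module_hom A M N" and "abelian_group M" "abelian_group N"
    and "finite I" "\<And>i. i \<in> I \<Longrightarrow> x i \<in> carrier M"
  shows "f (\<Oplus>\<^bsub>M\<^esub>i\<in>I. x i) = (\<Oplus>\<^bsub>N\<^esub>i\<in>I. f (x i))"
proof -
  interpret M: abelian_group M by fact
  interpret N: abelian_group N by fact
  show ?thesis using assms(4,5)
    by (induction I rule: finite_induct)
      (auto simp: module_hom_zero[OF assms(1-3)] module_hom_add[OF f] module_hom_closed[OF f] Pi_def
        M.finsum_closed)
qed

text \<open>Functions from \<open>G\<close> to an \<open>R\<close>-module with the convolution action of \<open>RG\<close>.\<close>

definition induced_module ::
    "('g, 'c) monoid_scheme \<Rightarrow> ('a, 'm, 'd) module_scheme \<Rightarrow> ('g \<Rightarrow> 'a, 'g \<Rightarrow> 'm) module"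
  where "induced_module G M = \<lparr>
    carrier = carrier G \<rightarrow>\<^sub>E carrier M,
    mult = undefined, one = undefined,
    zero = (\<lambda>g\<in>carrier G. \<zero>\<^bsub>M\<^esub>),
    add = (\<lambda>a b. \<lambda>g\<in>carrier G. a g \<oplus>\<^bsub>M\<^esub> b g),
    smult = (\<lambda>a b. \<lambda>g\<in>carrier G. \<Oplus>\<^bsub>M\<^esub>h\<in>carrier G. a h \<odot>\<^bsub>M\<^esub> b (inv\<^bsub>G\<^esub> h \<otimes>\<^bsub>G\<^esub> g))\<rparr>"

locale group_ring_setup = R?: cring R + G?: group G
  for R :: "('a, 'b) ring_scheme" and G :: "('g, 'c) monoid_scheme" +
  assumes finite_G [simp]: "finite (carrier G)"
begin

abbreviation "RG \<equiv> group_ring R G"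

lemma fun_abelian_group:
  assumes "abelian_group M" "carrier N = carrier G \<rightarrow>\<^sub>E carrier M"
    "zero N = (\<lambda>g\<in>carrier G. \<zero>\<^bsub>M\<^esub>)" "add N = (\<lambda>a b. \<lambda>g\<in>carrier G. a g \<oplus>\<^bsub>M\<^esub> b g)"
  shows "abelian_group N"
proof -
  interpret M: abelian_group M by fact
  show ?thesis
  proof (rule abelian_groupI, goal_cases)
    case (6 x)
    show ?case
      by (rule bexI[of _ "\<lambda>g\<in>carrier G. \<ominus>\<^bsub>M\<^esub> x g"])
        (use 6 in \<open>auto simp: assms PiE_iff fun_eq_iff M.l_neg\<close>)
  qed (auto simp: assms M.a_assoc PiE_iff extensional_def fun_eq_iff M.a_ac)
qed

lemma finsum_translate:
  assumes "abelian_monoid M" "k \<in> carrier G" "\<And>h. h \<in> carrier G \<Longrightarrow> F h \<in> carrier M"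
  shows "(\<Oplus>\<^bsub>M\<^esub>h\<in>carrier G. F h) = (\<Oplus>\<^bsub>M\<^esub>h\<in>carrier G. F (k \<otimes>\<^bsub>G\<^esub> h))"
proof -
  interpret M: abelian_monoid M by fact
  have "(\<lambda>h. k \<otimes>\<^bsub>G\<^esub> h) ` carrier G = carrier G" "inj_on (\<lambda>h. k \<otimes>\<^bsub>G\<^esub> h) (carrier G)"
    using assms(2) by (auto simp: G.surj_const_mult G.inj_on_multc intro: inj_onI)
  then show ?thesis
    using M.finsum_reindex[of F "\<lambda>h. k \<otimes>\<^bsub>G\<^esub> h" "carrier G"] assms(3) by (auto simp: Pi_def)
qed

definition "conv M a f = a \<odot>\<^bsub>induced_module G M\<^esub> f"

lemma conv_apply:
  "g \<in> carrier G \<Longrightarrow> conv M a f g = (\<Oplus>\<^bsub>M\<^esub>h\<in>carrier G. a h \<odot>\<^bsub>M\<^esub> f (inv\<^bsub>G\<^esub> h \<otimes>\<^bsub>G\<^esub> g))"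
  by (simp add: conv_def induced_module_def)

lemma conv_extensional: "conv M a f \<in> extensional (carrier G)"
  by (simp add: conv_def induced_module_def)

lemma RG_carrier: "carrier RG = carrier G \<rightarrow>\<^sub>E carrier R"
  by (simp add: group_ring_def)

definition "self = left_ideal_module R (carrier R)"

lemma self_simps [simp]: "carrier self = carrier R" "zero self = zero R" "add self = add R"
  "smult self = mult R"
  by (simp_all add: self_def left_ideal_module_def)

lemma finsum_self [simp]: "finsum self = finsum R"
  by (simp add: finsum_def finprod_def fun_eq_iff)

lemma module_self: "module R self"
proof (rule moduleI)
  show "cring R" ..
  show "abelian_group self" by (rule abelian_groupI) (auto simp: R.a_ac intro: R.l_neg)
qed (auto simp: R.l_distr R.r_distr R.m_assoc)

lemma RG_mult: "mult RG a b = conv self a b"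
  by (simp add: group_ring_def conv_def induced_module_def)

lemma fun_eqI:
  assumes "a \<in> extensional (carrier G)" "b \<in> extensional (carrier G)"
    "\<And>g. g \<in> carrier G \<Longrightarrow> a g = b g"
  shows "a = b"
  using assms by (rule extensionalityI)

lemma conv_closed:
  assumes "module R M" "a \<in> carrier RG" "f \<in> carrier G \<rightarrow>\<^sub>E carrier M"
  shows "conv M a f \<in> carrier G \<rightarrow>\<^sub>E carrier M"
proof -
  interpret M: module R M by fact
  show ?thesis using assms(2,3) conv_extensional
    by (auto simp: PiE_def conv_apply RG_carrier Pi_def intro!: M.M.finsum_closed M.smult_closed)
qed

lemma conv_add_left:
  assumes "module R M" "a \<in> carrier RG" "b \<in> carrier RG" "f \<in> carrier G \<rightarrow>\<^sub>E carrier M" "g \<in> carrier G"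
  shows "conv M (a \<oplus>\<^bsub>RG\<^esub> b) f g = conv M a f g \<oplus>\<^bsub>M\<^esub> conv M b f g"
proof -
  interpret M: module R M by fact
  have "conv M (a \<oplus>\<^bsub>RG\<^esub> b) f g = (\<Oplus>\<^bsub>M\<^esub>h\<in>carrier G.
      a h \<odot>\<^bsub>M\<^esub> f (inv\<^bsub>G\<^esub> h \<otimes>\<^bsub>G\<^esub> g) \<oplus>\<^bsub>M\<^esub> b h \<odot>\<^bsub>M\<^esub> f (inv\<^bsub>G\<^esub> h \<otimes>\<^bsub>G\<^esub> g))"
    unfolding conv_apply[OF assms(5)]
    using assms(2-5) by (intro M.M.finsum_cong')
      (auto simp: RG_carrier PiE_iff group_ring_def M.smult_l_distr intro!: M.smult_closed)
  also have "\<dots> = conv M a f g \<oplus>\<^bsub>M\<^esub> conv M b f g"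
    unfolding conv_apply[OF assms(5)]
    using assms(2-5) by (intro M.M.finsum_addf)
      (auto simp: RG_carrier PiE_iff intro!: M.smult_closed)
  finally show ?thesis .
qed

lemma conv_add_right:
  assumes "module R M" "a \<in> carrier RG" "f \<in> carrier G \<rightarrow>\<^sub>E carrier M" "f' \<in> carrier G \<rightarrow>\<^sub>E carrier M"
    "g \<in> carrier G"
  shows "conv M a (\<lambda>g\<in>carrier G. f g \<oplus>\<^bsub>M\<^esub> f' g) g = conv M a f g \<oplus>\<^bsub>M\<^esub> conv M a f' g"
proof -
  interpret M: module R M by fact
  have "conv M a (\<lambda>g\<in>carrier G. f g \<oplus>\<^bsub>M\<^esub> f' g) g = (\<Oplus>\<^bsub>M\<^esub>h\<in>carrier G.
      a h \<odot>\<^bsub>M\<^esub> f (inv\<^bsub>G\<^esub> h \<otimes>\<^bsub>G\<^esub> g) \<oplus>\<^bsub>M\<^esub> a h \<odot>\<^bsub>M\<^esub> f' (inv\<^bsub>G\<^esub> h \<otimes>\<^bsub>G\<^esub> g))"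
    unfolding conv_apply[OF assms(5)]
    using assms(2-5) by (intro M.M.finsum_cong')
      (auto simp: RG_carrier PiE_iff M.smult_r_distr intro!: M.smult_closed)
  also have "\<dots> = conv M a f g \<oplus>\<^bsub>M\<^esub> conv M a f' g"
    unfolding conv_apply[OF assms(5)]
    using assms(2-5) by (intro M.M.finsum_addf)
      (auto simp: RG_carrier PiE_iff intro!: M.smult_closed)
  finally show ?thesis .
qed

lemma finsum_smult_left:
  assumes "module R M" "finite I" "x \<in> carrier M" "\<And>i. i \<in> I \<Longrightarrow> f i \<in> carrier R"
  shows "(\<Oplus>\<^bsub>R\<^esub>i\<in>I. f i) \<odot>\<^bsub>M\<^esub> x = (\<Oplus>\<^bsub>M\<^esub>i\<in>I. f i \<odot>\<^bsub>M\<^esub> x)"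
proof -
  interpret M: module R M by fact
  show ?thesis using assms(2,4)
    by (induction I rule: finite_induct)
      (auto simp: M.smult_l_distr assms(3) Pi_def R.finsum_closed)
qed

lemma conv_assoc:
  assumes "module R M" "a \<in> carrier RG" "b \<in> carrier RG" "f \<in> carrier G \<rightarrow>\<^sub>E carrier M"
  shows "conv M (a \<otimes>\<^bsub>RG\<^esub> b) f = conv M a (conv M b f)"
proof (rule fun_eqI)
  interpret M: module R M by fact
  fix g assume g: "g \<in> carrier G"
  have aR: "a h \<in> carrier R" and bR: "b h \<in> carrier R" and fM: "f h \<in> carrier M"
    if "h \<in> carrier G" for h
    using that assms by (auto simp: RG_carrier PiE_iff)
  have "conv M (a \<otimes>\<^bsub>RG\<^esub> b) f g = (\<Oplus>\<^bsub>M\<^esub>h\<in>carrier G.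
      (\<Oplus>\<^bsub>R\<^esub>k\<in>carrier G. a k \<otimes>\<^bsub>R\<^esub> b (inv\<^bsub>G\<^esub> k \<otimes>\<^bsub>G\<^esub> h)) \<odot>\<^bsub>M\<^esub> f (inv\<^bsub>G\<^esub> h \<otimes>\<^bsub>G\<^esub> g))"
    unfolding conv_apply[OF g]
    using g by (intro M.M.finsum_cong')
      (auto simp: RG_mult conv_apply aR bR fM intro!: M.smult_closed R.finsum_closed)
  also have "\<dots> = (\<Oplus>\<^bsub>M\<^esub>h\<in>carrier G. \<Oplus>\<^bsub>M\<^esub>k\<in>carrier G.
      (a k \<otimes>\<^bsub>R\<^esub> b (inv\<^bsub>G\<^esub> k \<otimes>\<^bsub>G\<^esub> h)) \<odot>\<^bsub>M\<^esub> f (inv\<^bsub>G\<^esub> h \<otimes>\<^bsub>G\<^esub> g))"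
    using g by (intro M.M.finsum_cong')
      (auto simp: aR bR fM intro!: M.smult_closed M.M.finsum_closed finsum_smult_left assms(1))
  also have "\<dots> = (\<Oplus>\<^bsub>M\<^esub>k\<in>carrier G. \<Oplus>\<^bsub>M\<^esub>h\<in>carrier G.
      (a k \<otimes>\<^bsub>R\<^esub> b (inv\<^bsub>G\<^esub> k \<otimes>\<^bsub>G\<^esub> h)) \<odot>\<^bsub>M\<^esub> f (inv\<^bsub>G\<^esub> h \<otimes>\<^bsub>G\<^esub> g))"
    using g by (intro M.M.finsum_swap) (auto simp: aR bR fM intro!: M.smult_closed)
  also have "\<dots> = (\<Oplus>\<^bsub>M\<^esub>k\<in>carrier G. \<Oplus>\<^bsub>M\<^esub>h\<in>carrier G.
      (a k \<otimes>\<^bsub>R\<^esub> b h) \<odot>\<^bsub>M\<^esub> f (inv\<^bsub>G\<^esub> h \<otimes>\<^bsub>G\<^esub> (inv\<^bsub>G\<^esub> k \<otimes>\<^bsub>G\<^esub> g)))"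
  proof (rule M.M.finsum_cong')
    fix k assume k: "k \<in> carrier G"
    show "(\<Oplus>\<^bsub>M\<^esub>h\<in>carrier G.
        (a k \<otimes>\<^bsub>R\<^esub> b (inv\<^bsub>G\<^esub> k \<otimes>\<^bsub>G\<^esub> h)) \<odot>\<^bsub>M\<^esub> f (inv\<^bsub>G\<^esub> h \<otimes>\<^bsub>G\<^esub> g)) =
      (\<Oplus>\<^bsub>M\<^esub>h\<in>carrier G. (a k \<otimes>\<^bsub>R\<^esub> b h) \<odot>\<^bsub>M\<^esub> f (inv\<^bsub>G\<^esub> h \<otimes>\<^bsub>G\<^esub> (inv\<^bsub>G\<^esub> k \<otimes>\<^bsub>G\<^esub> g)))"
      using g k by (subst finsum_translate[OF M.M.abelian_monoid_axioms k])
        (auto simp: aR bR fM G.inv_mult_group G.m_assoc G.inv_solve_left' simp flip: G.m_assoc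
          intro!: M.smult_closed M.M.finsum_cong')
  qed (use g in \<open>auto simp: aR bR fM intro!: M.smult_closed M.M.finsum_closed\<close>)
  also have "\<dots> = (\<Oplus>\<^bsub>M\<^esub>k\<in>carrier G. a k \<odot>\<^bsub>M\<^esub> conv M b f (inv\<^bsub>G\<^esub> k \<otimes>\<^bsub>G\<^esub> g))"
  proof (rule M.M.finsum_cong')
    fix k assume k: "k \<in> carrier G"
    then have kg: "inv\<^bsub>G\<^esub> k \<otimes>\<^bsub>G\<^esub> g \<in> carrier G" using g by auto
    show "(\<Oplus>\<^bsub>M\<^esub>h\<in>carrier G. (a k \<otimes>\<^bsub>R\<^esub> b h) \<odot>\<^bsub>M\<^esub> f (inv\<^bsub>G\<^esub> h \<otimes>\<^bsub>G\<^esub> (inv\<^bsub>G\<^esub> k \<otimes>\<^bsub>G\<^esub> g)))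
      = a k \<odot>\<^bsub>M\<^esub> conv M b f (inv\<^bsub>G\<^esub> k \<otimes>\<^bsub>G\<^esub> g)"
      unfolding conv_apply[OF kg]
      using g k by (subst M.finsum_smult_ldistr)
        (auto simp: aR bR fM M.smult_assoc1 intro!: M.smult_closed M.M.finsum_cong')
  qed (use g in \<open>auto simp: aR bR fM conv_apply intro!: M.smult_closed M.M.finsum_closed\<close>)
  also have "\<dots> = conv M a (conv M b f) g"
    by (simp add: conv_apply[OF g])
  finally show "conv M (a \<otimes>\<^bsub>RG\<^esub> b) f g = conv M a (conv M b f) g" .
qed (rule conv_extensional)+

definition "delta k = (\<lambda>g\<in>carrier G. if g = k then \<one>\<^bsub>R\<^esub> else \<zero>\<^bsub>R\<^esub>)"

lemma delta_closed [simp]: "delta k \<in> carrier RG"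
  by (auto simp: delta_def RG_carrier)

lemma delta_apply: "g \<in> carrier G \<Longrightarrow> delta k g = (if g = k then \<one>\<^bsub>R\<^esub> else \<zero>\<^bsub>R\<^esub>)"
  by (simp add: delta_def)

lemma RG_one: "\<one>\<^bsub>RG\<^esub> = delta \<one>\<^bsub>G\<^esub>"
  by (simp add: group_ring_def delta_def)

lemma finsum_single:
  assumes "abelian_monoid M" "finite I" "k \<in> I" "x \<in> carrier M"
  shows "(\<Oplus>\<^bsub>M\<^esub>i\<in>I. if i = k then x else \<zero>\<^bsub>M\<^esub>) = x"
proof -
  interpret M: abelian_monoid M by fact
  show ?thesis using M.finsum_singleton[of k I "\<lambda>_. x"] assms by (simp add: eq_commute)
qed

lemma conv_delta:
  assumes "module R M" "k \<in> carrier G" "f \<in> carrier G \<rightarrow>\<^sub>E carrier M" "g \<in> carrier G"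
  shows "conv M (delta k) f g = f (inv\<^bsub>G\<^esub> k \<otimes>\<^bsub>G\<^esub> g)"
proof -
  interpret M: module R M by fact
  have "conv M (delta k) f g = (\<Oplus>\<^bsub>M\<^esub>h\<in>carrier G. if h = k then f (inv\<^bsub>G\<^esub> k \<otimes>\<^bsub>G\<^esub> g) else \<zero>\<^bsub>M\<^esub>)"
    unfolding conv_apply[OF assms(4)]
    using assms(2-4) by (intro M.M.finsum_cong') (auto simp: delta_def PiE_iff)
  then show ?thesis
    using assms(2-4) finsum_single[OF M.M.abelian_monoid_axioms finite_G assms(2)]
    by (auto simp: PiE_iff)
qed

lemma ring_RG: "ring RG"
proof -
  have ab: "abelian_group RG"
    by (rule fun_abelian_group[of R]) (auto simp: group_ring_def R.abelian_group_axioms)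
  note closed = conv_closed[OF module_self, simplified, folded RG_carrier]
  have RG_add: "a \<oplus>\<^bsub>RG\<^esub> b = (\<lambda>g\<in>carrier G. a g \<oplus>\<^bsub>R\<^esub> b g)" for a b
    by (simp add: group_ring_def)
  show ?thesis
  proof (rule ringI[OF ab])
    show "monoid RG"
    proof (rule monoidI)
      fix a b c assume abc: "a \<in> carrier RG" "b \<in> carrier RG" "c \<in> carrier RG"
      show "a \<otimes>\<^bsub>RG\<^esub> b \<otimes>\<^bsub>RG\<^esub> c = a \<otimes>\<^bsub>RG\<^esub> (b \<otimes>\<^bsub>RG\<^esub> c)"
        using conv_assoc[OF module_self abc(1,2)] abc(3) by (simp add: RG_mult RG_carrier)
    next
      show "a \<otimes>\<^bsub>RG\<^esub> b \<in> carrier RG" if "a \<in> carrier RG" "b \<in> carrier RG" for a b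
        using that by (simp add: RG_mult closed)
      show "\<one>\<^bsub>RG\<^esub> \<in> carrier RG" by (simp add: RG_one)
    next
      fix a assume abc: "a \<in> carrier RG"
      show "\<one>\<^bsub>RG\<^esub> \<otimes>\<^bsub>RG\<^esub> a = a"
        using abc(1) conv_delta[OF module_self G.one_closed, of a]
        by (intro fun_eqI) (auto simp: RG_one RG_mult conv_extensional RG_carrier PiE_def)
      show "a \<otimes>\<^bsub>RG\<^esub> \<one>\<^bsub>RG\<^esub> = a"
      proof (rule fun_eqI)
        fix g assume g: "g \<in> carrier G"
        have "(a \<otimes>\<^bsub>RG\<^esub> \<one>\<^bsub>RG\<^esub>) g = (\<Oplus>\<^bsub>R\<^esub>h\<in>carrier G. if h = g then a g else \<zero>\<^bsub>R\<^esub>)"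
          using abc(1) g unfolding RG_mult conv_apply[OF g]
          by (auto simp: RG_one delta_def RG_carrier PiE_iff G.inv_solve_left' intro!: R.finsum_cong')
        then show "(a \<otimes>\<^bsub>RG\<^esub> \<one>\<^bsub>RG\<^esub>) g = a g"
          using abc(1) g finsum_single[OF R.abelian_monoid_axioms finite_G g]
          by (auto simp: RG_carrier PiE_iff)
      qed (use abc(1) in \<open>auto simp: RG_mult conv_extensional RG_carrier PiE_def\<close>)
    qed
  next
    fix a b c assume abc: "a \<in> carrier RG" "b \<in> carrier RG" "c \<in> carrier RG"
    show "(a \<oplus>\<^bsub>RG\<^esub> b) \<otimes>\<^bsub>RG\<^esub> c = a \<otimes>\<^bsub>RG\<^esub> c \<oplus>\<^bsub>RG\<^esub> b \<otimes>\<^bsub>RG\<^esub> c"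
      using conv_add_left[OF module_self abc(1,2)] abc(3)
      by (intro fun_eqI) (auto simp: RG_mult conv_extensional RG_add[of "conv self a c"] RG_carrier)
    show "c \<otimes>\<^bsub>RG\<^esub> (a \<oplus>\<^bsub>RG\<^esub> b) = c \<otimes>\<^bsub>RG\<^esub> a \<oplus>\<^bsub>RG\<^esub> c \<otimes>\<^bsub>RG\<^esub> b"
      using conv_add_right[OF module_self abc(3)] abc(1,2)
      by (intro fun_eqI) (auto simp: RG_mult conv_extensional RG_add RG_carrier)
  qed
qed

abbreviation "emb \<equiv> scalar_embedding R G"

lemma emb_apply: "g \<in> carrier G \<Longrightarrow> r \<in> carrier R \<Longrightarrow>
    emb r g = (if g = \<one>\<^bsub>G\<^esub> then r else \<zero>\<^bsub>R\<^esub>)"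
  by (simp add: scalar_embedding_def group_ring_def)

lemma emb_closed [simp]: "r \<in> carrier R \<Longrightarrow> emb r \<in> carrier RG"
  by (auto simp: scalar_embedding_def group_ring_def)

lemma conv_emb:
  assumes "module R M" "r \<in> carrier R" "f \<in> carrier G \<rightarrow>\<^sub>E carrier M" "g \<in> carrier G"
  shows "conv M (emb r) f g = r \<odot>\<^bsub>M\<^esub> f g"
proof -
  interpret M: module R M by fact
  have "conv M (emb r) f g = (\<Oplus>\<^bsub>M\<^esub>h\<in>carrier G. if h = \<one>\<^bsub>G\<^esub> then r \<odot>\<^bsub>M\<^esub> f g else \<zero>\<^bsub>M\<^esub>)"
    unfolding conv_apply[OF assms(4)]
    using assms(2-4) by (intro M.M.finsum_cong') (auto simp: emb_apply PiE_iff)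
  then show ?thesis
    using assms(2-4) finsum_single[OF M.M.abelian_monoid_axioms finite_G G.one_closed]
    by (auto simp: PiE_iff)
qed

lemma emb_mult:
  assumes "r \<in> carrier R" "a \<in> carrier RG" "g \<in> carrier G"
  shows "(emb r \<otimes>\<^bsub>RG\<^esub> a) g = r \<otimes>\<^bsub>R\<^esub> a g"
  using conv_emb[OF module_self assms(1)] assms by (simp add: RG_mult RG_carrier)

lemma emb_central:
  assumes "r \<in> carrier R" "a \<in> carrier RG"
  shows "a \<otimes>\<^bsub>RG\<^esub> emb r = emb r \<otimes>\<^bsub>RG\<^esub> a"
proof (rule fun_eqI)
  fix g assume g: "g \<in> carrier G"
  have "(a \<otimes>\<^bsub>RG\<^esub> emb r) g = (\<Oplus>\<^bsub>R\<^esub>h\<in>carrier G. if h = g then r \<otimes>\<^bsub>R\<^esub> a g else \<zero>\<^bsub>R\<^esub>)"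
    using assms g unfolding RG_mult conv_apply[OF g]
    by (auto simp: emb_apply RG_carrier PiE_iff G.inv_solve_left' R.m_comm intro!: R.finsum_cong')
  also have "\<dots> = r \<otimes>\<^bsub>R\<^esub> a g"
    using assms g by (intro finsum_single) (auto simp: RG_carrier PiE_iff R.abelian_monoid_axioms)
  finally show "(a \<otimes>\<^bsub>RG\<^esub> emb r) g = (emb r \<otimes>\<^bsub>RG\<^esub> a) g"
    using emb_mult[OF assms g] by simp
qed (simp_all add: RG_mult conv_extensional)

lemma emb_hom:
  assumes "r \<in> carrier R" "s \<in> carrier R"
  shows "emb (r \<oplus>\<^bsub>R\<^esub> s) = emb r \<oplus>\<^bsub>RG\<^esub> emb s" "emb (r \<otimes>\<^bsub>R\<^esub> s) = emb r \<otimes>\<^bsub>RG\<^esub> emb s"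
    "emb \<one>\<^bsub>R\<^esub> = \<one>\<^bsub>RG\<^esub>"
proof -
  show "emb (r \<oplus>\<^bsub>R\<^esub> s) = emb r \<oplus>\<^bsub>RG\<^esub> emb s" "emb \<one>\<^bsub>R\<^esub> = \<one>\<^bsub>RG\<^esub>"
    using assms by (auto simp: scalar_embedding_def group_ring_def fun_eq_iff)
  show "emb (r \<otimes>\<^bsub>R\<^esub> s) = emb r \<otimes>\<^bsub>RG\<^esub> emb s"
  proof (rule fun_eqI)
    show "emb (r \<otimes>\<^bsub>R\<^esub> s) g = (emb r \<otimes>\<^bsub>RG\<^esub> emb s) g" if "g \<in> carrier G" for g
      using assms that by (simp add: emb_mult emb_apply)
  qed (simp_all add: RG_mult conv_extensional, simp add: scalar_embedding_def group_ring_def)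
qed

lemma delta_mult:
  assumes "h \<in> carrier G" "k \<in> carrier G"
  shows "delta h \<otimes>\<^bsub>RG\<^esub> delta k = delta (h \<otimes>\<^bsub>G\<^esub> k)"
proof (rule fun_eqI)
  fix g assume g: "g \<in> carrier G"
  have "(delta h \<otimes>\<^bsub>RG\<^esub> delta k) g = delta k (inv\<^bsub>G\<^esub> h \<otimes>\<^bsub>G\<^esub> g)"
    using conv_delta[OF module_self assms(1) _ g, of "delta k"] delta_closed[of k]
    by (simp add: RG_mult RG_carrier)
  then show "(delta h \<otimes>\<^bsub>RG\<^esub> delta k) g = delta (h \<otimes>\<^bsub>G\<^esub> k) g"
    using assms g by (auto simp: delta_def G.inv_solve_left' simp flip: G.m_assoc)
qed (auto simp: RG_mult conv_extensional delta_def)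

lemma RG_finsum_apply:
  assumes "finite I" "\<And>i. i \<in> I \<Longrightarrow> f i \<in> carrier RG" "g \<in> carrier G"
  shows "(\<Oplus>\<^bsub>RG\<^esub>i\<in>I. f i) g = (\<Oplus>\<^bsub>R\<^esub>i\<in>I. f i g)"
proof -
  interpret RG: ring RG by (rule ring_RG)
  have *: "x \<in> carrier RG \<Longrightarrow> x g \<in> carrier R" for x
    using assms(3) by (auto simp: RG_carrier PiE_iff)
  have z: "\<zero>\<^bsub>RG\<^esub> g = \<zero>\<^bsub>R\<^esub>" and p: "(x \<oplus>\<^bsub>RG\<^esub> y) g = x g \<oplus>\<^bsub>R\<^esub> y g" for x y
    using assms(3) by (simp_all add: group_ring_def)
  show ?thesis using assms(1,2)
    by (induction I rule: finite_induct) (auto simp: z p * Pi_def)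
qed

lemma RG_decomp:
  assumes "a \<in> carrier RG"
  shows "a = (\<Oplus>\<^bsub>RG\<^esub>h\<in>carrier G. emb (a h) \<otimes>\<^bsub>RG\<^esub> delta h)"
proof (rule fun_eqI)
  interpret RG: ring RG by (rule ring_RG)
  have aR: "a h \<in> carrier R" if "h \<in> carrier G" for h
    using that assms by (auto simp: RG_carrier PiE_iff)
  have cl: "(\<Oplus>\<^bsub>RG\<^esub>h\<in>carrier G. emb (a h) \<otimes>\<^bsub>RG\<^esub> delta h) \<in> carrier RG"
    by (auto intro!: RG.finsum_closed simp: aR)
  fix g assume g: "g \<in> carrier G"
  have "(\<Oplus>\<^bsub>RG\<^esub>h\<in>carrier G. emb (a h) \<otimes>\<^bsub>RG\<^esub> delta h) g
      = (\<Oplus>\<^bsub>R\<^esub>h\<in>carrier G. (emb (a h) \<otimes>\<^bsub>RG\<^esub> delta h) g)"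
    by (rule RG_finsum_apply) (auto simp: aR g)
  also have "\<dots> = (\<Oplus>\<^bsub>R\<^esub>h\<in>carrier G. if h = g then a g else \<zero>\<^bsub>R\<^esub>)"
    using g by (intro R.finsum_cong') (auto simp: emb_mult aR delta_apply)
  also have "\<dots> = a g"
    using g by (intro finsum_single) (auto simp: aR R.abelian_monoid_axioms)
  finally show "a g = (\<Oplus>\<^bsub>RG\<^esub>h\<in>carrier G. emb (a h) \<otimes>\<^bsub>RG\<^esub> delta h) g" ..
next
  interpret RG: ring RG by (rule ring_RG)
  have "(\<Oplus>\<^bsub>RG\<^esub>h\<in>carrier G. emb (a h) \<otimes>\<^bsub>RG\<^esub> delta h) \<in> carrier RG"
    using assms by (intro RG.finsum_closed funcsetI RG.m_closed emb_closed delta_closed)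
      (auto simp: RG_carrier PiE_iff)
  then show "(\<Oplus>\<^bsub>RG\<^esub>h\<in>carrier G. emb (a h) \<otimes>\<^bsub>RG\<^esub> delta h) \<in> extensional (carrier G)"
    by (simp add: RG_carrier PiE_def)
qed (use assms in \<open>auto simp: RG_carrier PiE_def\<close>)

lemma restrict_simps [simp]:
  "carrier (restrict_scalars f N) = carrier N" "zero (restrict_scalars f N) = zero N"
  "add (restrict_scalars f N) = add N" "smult (restrict_scalars f N) r x = smult N (f r) x"
  by (simp_all add: restrict_scalars_def)

lemma finsum_restrict [simp]: "finsum (restrict_scalars f N) = finsum N"
  by (simp add: finsum_def finprod_def fun_eq_iff)

lemma module_restrict:
  assumes "left_module RG N"
  shows "module R (restrict_scalars emb N)"
proof -
  interpret N: left_module RG N by fact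
  show ?thesis
  proof (rule moduleI)
    show "cring R" ..
    show "abelian_group (restrict_scalars emb N)"
      by (rule abelian_groupI) (auto simp: N.M.a_ac intro: N.M.l_neg)
  qed (auto simp: emb_hom N.smult_closed N.smult_l_distr N.smult_r_distr N.smult_assoc N.smult_one
        emb_hom(3)[OF R.one_closed R.one_closed])
qed

lemma induced_simps:
  "carrier (induced_module G M) = carrier G \<rightarrow>\<^sub>E carrier M"
  "zero (induced_module G M) = (\<lambda>g\<in>carrier G. \<zero>\<^bsub>M\<^esub>)"
  "add (induced_module G M) = (\<lambda>a b. \<lambda>g\<in>carrier G. a g \<oplus>\<^bsub>M\<^esub> b g)"
  "smult (induced_module G M) = conv M"
  by (simp_all add: induced_module_def conv_def fun_eq_iff)

lemma left_module_induced:
  assumes "module R M"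
  shows "left_module RG (induced_module G M)"
proof -
  interpret M: module R M by fact
  show ?thesis
  proof (rule left_moduleI)
    show "ring RG" by (rule ring_RG)
    show "abelian_group (induced_module G M)"
      by (rule fun_abelian_group[of M]) (auto simp: induced_simps M.M.abelian_group_axioms)
  next
    fix x assume x: "x \<in> carrier (induced_module G M)"
    show "\<one>\<^bsub>RG\<^esub> \<odot>\<^bsub>induced_module G M\<^esub> x = x"
      using x conv_delta[OF assms G.one_closed, of x]
      by (intro fun_eqI) (auto simp: RG_one induced_simps conv_extensional PiE_def)
  qed (use conv_closed[OF assms] conv_assoc[OF assms] conv_add_left[OF assms] conv_add_right[OF assms]
      in \<open>auto simp: induced_simps conv_extensional intro!: fun_eqI\<close>)
qed

definition "ind_hom N \<psi> f = (\<Oplus>\<^bsub>N\<^esub>x\<in>carrier G. delta x \<odot>\<^bsub>N\<^esub> \<psi> (f x))"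

lemma ind_hom:
  assumes "module R M" "left_module RG N" and \<psi>: "\<psi> \<in> module_hom R M (restrict_scalars emb N)"
  shows "ind_hom N \<psi> \<in> module_hom RG (induced_module G M) N"
proof -
  interpret M: module R M by fact
  interpret N: left_module RG N by fact
  interpret rN: module R "restrict_scalars emb N" by (rule module_restrict) fact
  have psi: "\<psi> x \<in> carrier N" if "x \<in> carrier M" for x
    using module_hom_closed[OF \<psi> that] by simp
  have psi_add: "\<psi> (x \<oplus>\<^bsub>M\<^esub> y) = \<psi> x \<oplus>\<^bsub>N\<^esub> \<psi> y" if "x \<in> carrier M" "y \<in> carrier M" for x y
    using module_hom_add[OF \<psi> that] by simp
  show ?thesis
    unfolding module_hom_def
  proof (intro CollectI conjI ballI funcsetI)
    fix f assume "f \<in> carrier (induced_module G M)"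
    then have f: "f x \<in> carrier M" if "x \<in> carrier G" for x
      using that by (auto simp: induced_simps PiE_iff)
    show cl: "ind_hom N \<psi> f \<in> carrier N"
      unfolding ind_hom_def by (auto intro!: N.M.finsum_closed N.smult_closed psi f)
    {
      fix f' assume "f' \<in> carrier (induced_module G M)"
      then have f': "f' x \<in> carrier M" if "x \<in> carrier G" for x
        using that by (auto simp: induced_simps PiE_iff)
      have "ind_hom N \<psi> (f \<oplus>\<^bsub>induced_module G M\<^esub> f') = (\<Oplus>\<^bsub>N\<^esub>x\<in>carrier G.
          delta x \<odot>\<^bsub>N\<^esub> \<psi> (f x) \<oplus>\<^bsub>N\<^esub> delta x \<odot>\<^bsub>N\<^esub> \<psi> (f' x))"
        unfolding ind_hom_def
        by (intro N.M.finsum_cong')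
          (auto simp: induced_simps psi_add psi f f' N.smult_r_distr intro!: N.smult_closed)
      also have "\<dots> = ind_hom N \<psi> f \<oplus>\<^bsub>N\<^esub> ind_hom N \<psi> f'"
        unfolding ind_hom_def
        by (intro N.M.finsum_addf) (auto simp: psi f f' intro!: N.smult_closed)
      finally show "ind_hom N \<psi> (f \<oplus>\<^bsub>induced_module G M\<^esub> f') = ind_hom N \<psi> f \<oplus>\<^bsub>N\<^esub> ind_hom N \<psi> f'" .
    }
    fix a assume a: "a \<in> carrier RG"
    then have aR: "a h \<in> carrier R" if "h \<in> carrier G" for h
      using that by (auto simp: RG_carrier PiE_iff)
    have step: "delta (h \<otimes>\<^bsub>G\<^esub> y) \<odot>\<^bsub>N\<^esub> (emb (a h) \<odot>\<^bsub>N\<^esub> \<psi> (f y))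
        = (emb (a h) \<otimes>\<^bsub>RG\<^esub> delta h) \<odot>\<^bsub>N\<^esub> (delta y \<odot>\<^bsub>N\<^esub> \<psi> (f y))"
      if "h \<in> carrier G" "y \<in> carrier G" for h y
    proof -
      have "delta (h \<otimes>\<^bsub>G\<^esub> y) \<odot>\<^bsub>N\<^esub> (emb (a h) \<odot>\<^bsub>N\<^esub> \<psi> (f y))
          = (delta (h \<otimes>\<^bsub>G\<^esub> y) \<otimes>\<^bsub>RG\<^esub> emb (a h)) \<odot>\<^bsub>N\<^esub> \<psi> (f y)"
        using that by (simp add: N.smult_assoc aR psi f)
      also have "\<dots> = ((emb (a h) \<otimes>\<^bsub>RG\<^esub> delta h) \<otimes>\<^bsub>RG\<^esub> delta y) \<odot>\<^bsub>N\<^esub> \<psi> (f y)"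
        using that by (simp add: emb_central aR N.A.m_assoc flip: delta_mult)
      also have "\<dots> = (emb (a h) \<otimes>\<^bsub>RG\<^esub> delta h) \<odot>\<^bsub>N\<^esub> (delta y \<odot>\<^bsub>N\<^esub> \<psi> (f y))"
        using that by (intro N.smult_assoc) (auto simp: aR psi f)
      finally show ?thesis .
    qed
    have "ind_hom N \<psi> (a \<odot>\<^bsub>induced_module G M\<^esub> f) = (\<Oplus>\<^bsub>N\<^esub>x\<in>carrier G. \<Oplus>\<^bsub>N\<^esub>h\<in>carrier G.
        delta x \<odot>\<^bsub>N\<^esub> (emb (a h) \<odot>\<^bsub>N\<^esub> \<psi> (f (inv\<^bsub>G\<^esub> h \<otimes>\<^bsub>G\<^esub> x))))"
      unfolding ind_hom_def
    proof (rule N.M.finsum_cong')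
      fix x assume x: "x \<in> carrier G"
      have "\<psi> ((a \<odot>\<^bsub>induced_module G M\<^esub> f) x) =
          (\<Oplus>\<^bsub>N\<^esub>h\<in>carrier G. \<psi> (a h \<odot>\<^bsub>M\<^esub> f (inv\<^bsub>G\<^esub> h \<otimes>\<^bsub>G\<^esub> x)))"
        using module_hom_finsum[OF \<psi> M.M.abelian_group_axioms rN.M.abelian_group_axioms finite_G,
            of "\<lambda>h. a h \<odot>\<^bsub>M\<^esub> f (inv\<^bsub>G\<^esub> h \<otimes>\<^bsub>G\<^esub> x)"] x
        by (simp add: induced_simps conv_apply aR f)
      also have "\<dots> = (\<Oplus>\<^bsub>N\<^esub>h\<in>carrier G. emb (a h) \<odot>\<^bsub>N\<^esub> \<psi> (f (inv\<^bsub>G\<^esub> h \<otimes>\<^bsub>G\<^esub> x)))"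
        using x module_hom_smult[OF \<psi>] by (intro N.M.finsum_cong') (auto simp: aR f psi N.smult_closed)
      finally show "delta x \<odot>\<^bsub>N\<^esub> \<psi> ((a \<odot>\<^bsub>induced_module G M\<^esub> f) x) = (\<Oplus>\<^bsub>N\<^esub>h\<in>carrier G.
          delta x \<odot>\<^bsub>N\<^esub> (emb (a h) \<odot>\<^bsub>N\<^esub> \<psi> (f (inv\<^bsub>G\<^esub> h \<otimes>\<^bsub>G\<^esub> x))))"
        using x by (simp add: N.smult_finsum_right aR f psi N.smult_closed)
    qed (auto intro!: N.M.finsum_closed simp: aR f psi N.smult_closed)
    also have "\<dots> = (\<Oplus>\<^bsub>N\<^esub>h\<in>carrier G. \<Oplus>\<^bsub>N\<^esub>x\<in>carrier G.
        delta x \<odot>\<^bsub>N\<^esub> (emb (a h) \<odot>\<^bsub>N\<^esub> \<psi> (f (inv\<^bsub>G\<^esub> h \<otimes>\<^bsub>G\<^esub> x))))"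
      by (intro N.M.finsum_swap) (auto simp: aR f psi N.smult_closed)
    also have "\<dots> = (\<Oplus>\<^bsub>N\<^esub>h\<in>carrier G. (emb (a h) \<otimes>\<^bsub>RG\<^esub> delta h) \<odot>\<^bsub>N\<^esub> ind_hom N \<psi> f)"
    proof (rule N.M.finsum_cong')
      fix h assume h: "h \<in> carrier G"
      have "(\<Oplus>\<^bsub>N\<^esub>x\<in>carrier G. delta x \<odot>\<^bsub>N\<^esub> (emb (a h) \<odot>\<^bsub>N\<^esub> \<psi> (f (inv\<^bsub>G\<^esub> h \<otimes>\<^bsub>G\<^esub> x))))
        = (\<Oplus>\<^bsub>N\<^esub>y\<in>carrier G. delta (h \<otimes>\<^bsub>G\<^esub> y) \<odot>\<^bsub>N\<^esub> (emb (a h) \<odot>\<^bsub>N\<^esub> \<psi> (f (inv\<^bsub>G\<^esub> h \<otimes>\<^bsub>G\<^esub> (h \<otimes>\<^bsub>G\<^esub> y)))))"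
        using h by (intro finsum_translate[OF N.M.abelian_monoid_axioms h])
          (auto simp: aR f psi N.smult_closed)
      also have "\<dots> = (\<Oplus>\<^bsub>N\<^esub>y\<in>carrier G.
          (emb (a h) \<otimes>\<^bsub>RG\<^esub> delta h) \<odot>\<^bsub>N\<^esub> (delta y \<odot>\<^bsub>N\<^esub> \<psi> (f y)))"
        using h by (intro N.M.finsum_cong')
          (auto simp: aR f psi N.smult_closed step simp flip: G.m_assoc)
      also have "\<dots> = (emb (a h) \<otimes>\<^bsub>RG\<^esub> delta h) \<odot>\<^bsub>N\<^esub> ind_hom N \<psi> f"
        unfolding ind_hom_def using h
        by (simp add: N.smult_finsum_right aR f psi N.smult_closed)
      finally show "(\<Oplus>\<^bsub>N\<^esub>x\<in>carrier G. delta x \<odot>\<^bsub>N\<^esub> (emb (a h) \<odot>\<^bsub>N\<^esub> \<psi> (f (inv\<^bsub>G\<^esub> h \<otimes>\<^bsub>G\<^esub> x))))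
        = (emb (a h) \<otimes>\<^bsub>RG\<^esub> delta h) \<odot>\<^bsub>N\<^esub> ind_hom N \<psi> f" .
    qed (auto intro!: N.smult_closed cl simp: aR)
    also have "\<dots> = (\<Oplus>\<^bsub>RG\<^esub>h\<in>carrier G. emb (a h) \<otimes>\<^bsub>RG\<^esub> delta h) \<odot>\<^bsub>N\<^esub> ind_hom N \<psi> f"
      by (rule N.smult_finsum_left[symmetric]) (auto simp: aR cl)
    also have "\<dots> = a \<odot>\<^bsub>N\<^esub> ind_hom N \<psi> f"
      by (simp flip: RG_decomp[OF a])
    finally show "ind_hom N \<psi> (a \<odot>\<^bsub>induced_module G M\<^esub> f) = a \<odot>\<^bsub>N\<^esub> ind_hom N \<psi> f" .
  qed
qed

lemma left_ideal_module_simps: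
  "carrier (left_ideal_module A I) = I" "zero (left_ideal_module A I) = zero A"
  "add (left_ideal_module A I) = add A" "smult (left_ideal_module A I) = mult A"
  by (simp_all add: left_ideal_module_def)

lemma left_module_left_ideal:
  assumes "left_ideal I A"
  shows "left_module A (left_ideal_module A I)"
proof -
  interpret I: left_ideal I A by fact
  show ?thesis
  proof (rule left_moduleI)
    show "abelian_group (left_ideal_module A I)"
    proof (rule abelian_groupI, goal_cases)
      case (6 x)
      then have "\<ominus>\<^bsub>A\<^esub> x \<in> I" using I.a_subgroup[THEN subgroup.m_inv_closed] by (simp add: a_inv_def left_ideal_module_simps)
      then show ?case using 6 by (intro bexI[of _ "\<ominus>\<^bsub>A\<^esub> x"]) (auto simp: left_ideal_module_simps I.l_neg)
    qed (auto simp: left_ideal_module_simps I.a_closed I.a_ac)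
  qed (auto simp: left_ideal_module_simps I.l_closed I.l_distr I.r_distr I.m_assoc I.ring_axioms)
qed

lemma left_module_kernel:
  assumes "left_module A N" "left_module A M" and f: "f \<in> module_hom A N M"
  shows "left_module A (N\<lparr>carrier := {x \<in> carrier N. f x = \<zero>\<^bsub>M\<^esub>}\<rparr>)"
proof -
  interpret N: left_module A N by fact
  interpret M: left_module A M by fact
  note hz = module_hom_zero[OF f N.M.abelian_group_axioms M.M.abelian_group_axioms]
  show ?thesis
  proof (rule left_moduleI)
    show "ring A" ..
    show "abelian_group (N\<lparr>carrier := {x \<in> carrier N. f x = \<zero>\<^bsub>M\<^esub>}\<rparr>)"
    proof (rule abelian_groupI, goal_cases)
      case (6 x)
      then have x: "x \<in> carrier N" "f x = \<zero>\<^bsub>M\<^esub>" by auto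
      have "\<zero>\<^bsub>M\<^esub> = f (\<ominus>\<^bsub>N\<^esub> x \<oplus>\<^bsub>N\<^esub> x)" using x by (simp add: N.M.l_neg hz)
      also have "\<dots> = f (\<ominus>\<^bsub>N\<^esub> x)"
        using x module_hom_closed[OF f, of "\<ominus>\<^bsub>N\<^esub> x"] by (simp add: module_hom_add[OF f])
      finally show ?case using x by (intro bexI[of _ "\<ominus>\<^bsub>N\<^esub> x"]) (auto simp: N.M.l_neg)
    qed (auto simp: N.M.a_ac module_hom_add[OF f] hz)
  qed (auto simp: module_hom_smult[OF f] N.smult_closed N.smult_l_distr N.smult_r_distr
      N.smult_assoc N.smult_one M.smult_r_zero)
qed

lemma group_code_dual:
  assumes "group_code R G C"
  shows "group_code R G (dual_code R G C)"
proof -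
  interpret RG: ring RG by (rule ring_RG)
  interpret C: left_ideal C RG using assms by (simp add: group_code_def)
  have coeff: "v h \<in> carrier R" if "v \<in> carrier RG" "h \<in> carrier G" for v h
    using that by (auto simp: RG_carrier PiE_iff)
  have add: "code_form R G c (v \<oplus>\<^bsub>RG\<^esub> w) = code_form R G c v \<oplus>\<^bsub>R\<^esub> code_form R G c w"
    if cvw: "c \<in> carrier RG" "v \<in> carrier RG" "w \<in> carrier RG" for c v w
  proof -
    have "code_form R G c (v \<oplus>\<^bsub>RG\<^esub> w) = (\<Oplus>\<^bsub>R\<^esub>g\<in>carrier G. c g \<otimes>\<^bsub>R\<^esub> v g \<oplus>\<^bsub>R\<^esub> c g \<otimes>\<^bsub>R\<^esub> w g)"
      unfolding code_form_def using coeff[OF cvw(1)] coeff[OF cvw(2)] coeff[OF cvw(3)]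
      by (intro R.finsum_cong') (auto simp: group_ring_def R.r_distr)
    then show ?thesis
      unfolding code_form_def using coeff[OF cvw(1)] coeff[OF cvw(2)] coeff[OF cvw(3)]
      by (simp add: R.finsum_addf Pi_def)
  qed
  have form_closed: "code_form R G c v \<in> carrier R" if "c \<in> carrier RG" "v \<in> carrier RG" for c v
    unfolding code_form_def using that coeff by (auto intro!: R.finsum_closed)
  have smult: "code_form R G c (a \<otimes>\<^bsub>RG\<^esub> v) = \<zero>\<^bsub>R\<^esub>"
    if "c \<in> C" "a \<in> carrier RG" "v \<in> dual_code R G C" for c a v
  proof -
    have v: "v \<in> carrier RG" and cv: "\<And>c. c \<in> C \<Longrightarrow> code_form R G c v = \<zero>\<^bsub>R\<^esub>"
      using that(3) by (auto simp: dual_code_def)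
    have c: "c \<in> carrier RG" using that(1) by simp
    note co = coeff[OF c] coeff[OF v] coeff[OF that(2)]
    have "code_form R G c (a \<otimes>\<^bsub>RG\<^esub> v) = (\<Oplus>\<^bsub>R\<^esub>g\<in>carrier G. \<Oplus>\<^bsub>R\<^esub>h\<in>carrier G.
        a h \<otimes>\<^bsub>R\<^esub> (c g \<otimes>\<^bsub>R\<^esub> v (inv\<^bsub>G\<^esub> h \<otimes>\<^bsub>G\<^esub> g)))"
      unfolding code_form_def
    proof (rule R.finsum_cong')
      fix g assume g: "g \<in> carrier G"
      have "c g \<otimes>\<^bsub>R\<^esub> (a \<otimes>\<^bsub>RG\<^esub> v) g =
          (\<Oplus>\<^bsub>R\<^esub>h\<in>carrier G. c g \<otimes>\<^bsub>R\<^esub> (a h \<otimes>\<^bsub>R\<^esub> v (inv\<^bsub>G\<^esub> h \<otimes>\<^bsub>G\<^esub> g)))"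
        using g by (simp add: RG_mult conv_apply co R.finsum_rdistr Pi_def)
      also have "\<dots> = (\<Oplus>\<^bsub>R\<^esub>h\<in>carrier G. a h \<otimes>\<^bsub>R\<^esub> (c g \<otimes>\<^bsub>R\<^esub> v (inv\<^bsub>G\<^esub> h \<otimes>\<^bsub>G\<^esub> g)))"
        using g by (intro R.finsum_cong') (auto simp: co R.m_lcomm)
      finally show "c g \<otimes>\<^bsub>R\<^esub> (a \<otimes>\<^bsub>RG\<^esub> v) g =
          (\<Oplus>\<^bsub>R\<^esub>h\<in>carrier G. a h \<otimes>\<^bsub>R\<^esub> (c g \<otimes>\<^bsub>R\<^esub> v (inv\<^bsub>G\<^esub> h \<otimes>\<^bsub>G\<^esub> g)))" .
    qed (auto simp: co intro!: R.finsum_closed)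
    also have "\<dots> = (\<Oplus>\<^bsub>R\<^esub>h\<in>carrier G. \<Oplus>\<^bsub>R\<^esub>g\<in>carrier G.
        a h \<otimes>\<^bsub>R\<^esub> (c g \<otimes>\<^bsub>R\<^esub> v (inv\<^bsub>G\<^esub> h \<otimes>\<^bsub>G\<^esub> g)))"
      by (rule R.finsum_swap) (auto simp: co)
    also have "\<dots> = (\<Oplus>\<^bsub>R\<^esub>h\<in>carrier G. \<zero>\<^bsub>R\<^esub>)"
    proof (rule R.finsum_cong')
      fix h assume h: "h \<in> carrier G"
      have "(\<Oplus>\<^bsub>R\<^esub>g\<in>carrier G. a h \<otimes>\<^bsub>R\<^esub> (c g \<otimes>\<^bsub>R\<^esub> v (inv\<^bsub>G\<^esub> h \<otimes>\<^bsub>G\<^esub> g)))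
          = a h \<otimes>\<^bsub>R\<^esub> (\<Oplus>\<^bsub>R\<^esub>g\<in>carrier G. c g \<otimes>\<^bsub>R\<^esub> v (inv\<^bsub>G\<^esub> h \<otimes>\<^bsub>G\<^esub> g))"
        using h by (simp add: co R.finsum_rdistr Pi_def)
      also have "(\<Oplus>\<^bsub>R\<^esub>g\<in>carrier G. c g \<otimes>\<^bsub>R\<^esub> v (inv\<^bsub>G\<^esub> h \<otimes>\<^bsub>G\<^esub> g))
          = (\<Oplus>\<^bsub>R\<^esub>y\<in>carrier G. c (h \<otimes>\<^bsub>G\<^esub> y) \<otimes>\<^bsub>R\<^esub> v (inv\<^bsub>G\<^esub> h \<otimes>\<^bsub>G\<^esub> (h \<otimes>\<^bsub>G\<^esub> y)))"
        using h by (intro finsum_translate[OF R.abelian_monoid_axioms h]) (auto simp: co)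
      also have "\<dots> = code_form R G (delta (inv\<^bsub>G\<^esub> h) \<otimes>\<^bsub>RG\<^esub> c) v"
        unfolding code_form_def
        using h conv_delta[OF module_self G.inv_closed[OF h], of c] c
        by (intro R.finsum_cong') (auto simp: co RG_mult RG_carrier simp flip: G.m_assoc)
      also have "\<dots> = \<zero>\<^bsub>R\<^esub>" by (intro cv C.l_closed that) simp
      finally show "(\<Oplus>\<^bsub>R\<^esub>g\<in>carrier G. a h \<otimes>\<^bsub>R\<^esub> (c g \<otimes>\<^bsub>R\<^esub> v (inv\<^bsub>G\<^esub> h \<otimes>\<^bsub>G\<^esub> g))) = \<zero>\<^bsub>R\<^esub>"
        using h by (simp add: co)
    qed auto
    finally show ?thesis by (simp add: R.finsum_zero)
  qed
  have zero: "code_form R G c \<zero>\<^bsub>RG\<^esub> = \<zero>\<^bsub>R\<^esub>" if "c \<in> carrier RG" for c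
    using add[OF that RG.zero_closed RG.zero_closed] form_closed[OF that RG.zero_closed]
    by (metis R.add.r_cancel_one RG.l_zero RG.zero_closed)
  show ?thesis
    unfolding group_code_def
  proof (intro left_ideal.intro left_ideal_axioms.intro additive_subgroupI RG.ring_axioms)
    show "subgroup (dual_code R G C) (add_monoid RG)"
    proof (rule group.subgroupI[OF RG.a_group])
      show "dual_code R G C \<subseteq> carrier (add_monoid RG)" by (auto simp: dual_code_def)
      show "dual_code R G C \<noteq> {}" using zero C.a_subset by (auto simp: dual_code_def)
      show "x \<otimes>\<^bsub>add_monoid RG\<^esub> y \<in> dual_code R G C"
        if "x \<in> dual_code R G C" "y \<in> dual_code R G C" for x y
        using that by (auto simp: dual_code_def add)
      show "inv\<^bsub>add_monoid RG\<^esub> x \<in> dual_code R G C" if "x \<in> dual_code R G C" for x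
      proof -
        have x: "x \<in> carrier RG" "\<ominus>\<^bsub>RG\<^esub> x \<in> carrier RG" using that by (auto simp: dual_code_def)
        have "code_form R G c (\<ominus>\<^bsub>RG\<^esub> x) = \<zero>\<^bsub>R\<^esub>" if c: "c \<in> C" for c
        proof -
          have c': "c \<in> carrier RG" using c by simp
          have "\<zero>\<^bsub>R\<^esub> = code_form R G c (x \<oplus>\<^bsub>RG\<^esub> \<ominus>\<^bsub>RG\<^esub> x)"
            using zero[OF c'] x(1) by (simp only: RG.r_neg)
          also have "\<dots> = code_form R G c x \<oplus>\<^bsub>R\<^esub> code_form R G c (\<ominus>\<^bsub>RG\<^esub> x)"
            by (rule add[OF c' x])
          also have "code_form R G c x = \<zero>\<^bsub>R\<^esub>"
            using \<open>x \<in> dual_code R G C\<close> c by (simp add: dual_code_def)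
          finally show ?thesis using form_closed[OF c' x(2)] by simp
        qed
        then show ?thesis using x by (auto simp: dual_code_def simp flip: a_inv_def)
      qed
    qed
    show "x \<otimes>\<^bsub>RG\<^esub> a \<in> dual_code R G C" if "a \<in> dual_code R G C" "x \<in> carrier RG" for a x
      using that smult by (auto simp: dual_code_def)
  qed
qed

theorem relative_projective_universe:
  assumes "group_code R G C" "relative_projective R G C"
  shows "relative_projective_on TYPE('n) R G C"
  unfolding relative_projective_on_def Let_def
proof (intro allI impI)
  fix K :: "('g \<Rightarrow> 'a, 'n) module" and \<iota> and N :: "('g \<Rightarrow> 'a, 'n) module" and \<phi>
  define CM where "CM = left_ideal_module RG C"
  define M where "M = restrict_scalars emb CM"
  assume ses: "short_exact_modules RG K \<iota> N \<phi> (left_ideal_module RG C)"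
  assume "\<exists>\<psi>\<in>module_hom R (restrict_scalars emb (left_ideal_module RG C)) (restrict_scalars emb N).
      \<forall>c\<in>C. \<phi> (\<psi> c) = c"
  then obtain \<psi> where \<psi>: "\<psi> \<in> module_hom R M (restrict_scalars emb N)" "\<And>c. c \<in> C \<Longrightarrow> \<phi> (\<psi> c) = c"
    by (auto simp: M_def CM_def)
  have [simp]: "carrier CM = C" by (simp add: CM_def left_ideal_module_simps)
  interpret CM: left_module RG CM
    using left_module_left_ideal assms(1) by (auto simp: CM_def group_code_def)
  interpret M: module R M
    unfolding M_def by (rule module_restrict) (rule CM.left_module_axioms)
  have [simp]: "carrier M = C" by (simp add: M_def)
  interpret N: left_module RG N
    using ses by (simp add: short_exact_modules_def)
  have \<phi>: "\<phi> \<in> module_hom RG N CM" using ses by (simp add: short_exact_modules_def CM_def)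
  define I where "I = induced_module G M"
  interpret I: left_module RG I
    unfolding I_def by (rule left_module_induced) (rule M.module_axioms)
  define \<Phi> where "\<Phi> = ind_hom CM (\<lambda>x. x)"
  have \<Phi>: "\<Phi> \<in> module_hom RG I CM"
    unfolding \<Phi>_def I_def using M.module_axioms CM.left_module_axioms
    by (rule ind_hom) (auto simp: module_hom_def M_def)
  define sec where "sec c = (\<lambda>x\<in>carrier G. if x = \<one>\<^bsub>G\<^esub> then c else \<zero>\<^bsub>M\<^esub>)" for c
  have sec_closed: "sec c \<in> carrier I" if "c \<in> C" for c
    using that M.M.zero_closed by (auto simp: I_def induced_simps sec_def)
  have sec: "sec \<in> module_hom R M (restrict_scalars emb I)"
    unfolding module_hom_def
  proof (intro CollectI conjI ballI funcsetI)
    fix c assume c: "c \<in> carrier M"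
    show "sec c \<in> carrier (restrict_scalars emb I)" using c sec_closed by simp
    show "sec (c \<oplus>\<^bsub>M\<^esub> d) = sec c \<oplus>\<^bsub>restrict_scalars emb I\<^esub> sec d" if "d \<in> carrier M" for d
      using c that M.M.a_closed M.M.zero_closed by (auto simp: I_def induced_simps sec_def fun_eq_iff)
    fix r assume r: "r \<in> carrier R"
    have "sec (r \<odot>\<^bsub>M\<^esub> c) = conv M (emb r) (sec c)"
    proof (rule fun_eqI)
      fix g assume g: "g \<in> carrier G"
      show "sec (r \<odot>\<^bsub>M\<^esub> c) g = conv M (emb r) (sec c) g"
        using conv_emb[OF M.module_axioms r _ g, of "sec c"] sec_closed[of c] c g r
        by (simp add: I_def induced_simps) (simp add: sec_def)
    qed (simp_all add: conv_extensional sec_def)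
    then show "sec (r \<odot>\<^bsub>M\<^esub> c) = r \<odot>\<^bsub>restrict_scalars emb I\<^esub> sec c"
      by (simp add: I_def induced_simps)
  qed
  have \<Phi>_sec: "\<Phi> (sec c) = c" if c: "c \<in> C" for c
  proof -
    have "\<Phi> (sec c) = (\<Oplus>\<^bsub>CM\<^esub>x\<in>carrier G. if x = \<one>\<^bsub>G\<^esub> then c else \<zero>\<^bsub>CM\<^esub>)"
      unfolding \<Phi>_def ind_hom_def
      using c CM.smult_one[of c] CM.M.zero_closed
      by (intro CM.M.finsum_cong') (auto simp: sec_def M_def CM.smult_r_zero RG_one)
    also have "\<dots> = c" using c by (intro finsum_single) (auto simp: CM.M.abelian_monoid_axioms)
    finally show ?thesis .
  qed
  have "short_exact_modules RG (I\<lparr>carrier := {x \<in> carrier I. \<Phi> x = \<zero>\<^bsub>CM\<^esub>}\<rparr>) (\<lambda>x. x) I \<Phi> CM"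
    unfolding short_exact_modules_def
  proof (intro conjI)
    show "\<Phi> ` carrier I = carrier CM"
    proof
      show "\<Phi> ` carrier I \<subseteq> carrier CM" using module_hom_closed[OF \<Phi>] by auto
      show "carrier CM \<subseteq> \<Phi> ` carrier I"
        using \<Phi>_sec sec_closed by (metis \<open>carrier CM = C\<close> image_eqI subsetI)
    qed
    show "left_module RG (I\<lparr>carrier := {x \<in> carrier I. \<Phi> x = \<zero>\<^bsub>CM\<^esub>}\<rparr>)"
      using I.left_module_axioms CM.left_module_axioms \<Phi> by (rule left_module_kernel)
    show "(\<lambda>x. x) \<in> module_hom RG (I\<lparr>carrier := {x \<in> carrier I. \<Phi> x = \<zero>\<^bsub>CM\<^esub>}\<rparr>) I"
      by (auto simp: module_hom_def)
  qed (auto simp: \<Phi> I.left_module_axioms CM.left_module_axioms)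
  moreover have "\<exists>\<psi>\<in>module_hom R (restrict_scalars emb CM) (restrict_scalars emb I).
      \<forall>c\<in>C. \<Phi> (\<psi> c) = c"
    using sec \<Phi>_sec by (intro bexI[of _ sec]) (simp_all add: M_def)
  ultimately have "\<exists>\<sigma>\<in>module_hom RG CM I. \<forall>c\<in>C. \<Phi> (\<sigma> c) = c"
    using assms(2)[unfolded relative_projective_def relative_projective_on_def Let_def, rule_format]
    unfolding CM_def by fast
  then obtain \<sigma> where \<sigma>: "\<sigma> \<in> module_hom RG CM I" "\<And>c. c \<in> C \<Longrightarrow> \<Phi> (\<sigma> c) = c" by auto
  define \<Psi> where "\<Psi> = ind_hom N \<psi>"
  have \<Psi>: "\<Psi> \<in> module_hom RG I N"
    unfolding \<Psi>_def I_def using M.module_axioms N.left_module_axioms \<psi>(1) by (rule ind_hom)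
  have "(\<lambda>c. \<Psi> (\<sigma> c)) \<in> module_hom RG CM N"
    using \<Psi> \<sigma>(1) by (auto simp: module_hom_def Pi_def)
  moreover have "\<phi> (\<Psi> (\<sigma> c)) = c" if c: "c \<in> C" for c
  proof -
    have s: "\<sigma> c x \<in> C" if "x \<in> carrier G" for x
      using module_hom_closed[OF \<sigma>(1), of c] c that by (auto simp: I_def induced_simps PiE_iff)
    have p: "\<psi> x \<in> carrier N" if "x \<in> C" for x
      using module_hom_closed[OF \<psi>(1), of x] that by simp
    have "\<phi> (\<Psi> (\<sigma> c)) = (\<Oplus>\<^bsub>CM\<^esub>x\<in>carrier G. \<phi> (delta x \<odot>\<^bsub>N\<^esub> \<psi> (\<sigma> c x)))"
      unfolding \<Psi>_def ind_hom_def
      using \<phi> N.M.abelian_group_axioms CM.M.abelian_group_axioms finite_G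
      by (rule module_hom_finsum) (auto simp: s p N.smult_closed)
    also have "\<dots> = \<Phi> (\<sigma> c)"
      unfolding \<Phi>_def ind_hom_def
      using CM.smult_closed
      by (intro CM.M.finsum_cong') (auto simp: module_hom_smult[OF \<phi>] s p \<psi>(2))
    finally show ?thesis using \<sigma>(2) c by simp
  qed
  ultimately show "\<exists>\<psi>'\<in>module_hom RG (left_ideal_module RG C) N. \<forall>c\<in>C. \<phi> (\<psi>' c) = c"
    unfolding CM_def by (intro bexI[of _ "\<lambda>c. \<Psi> (\<sigma> c)"]) auto
qed

end

end

theory Submission
  imports Defs
begin

text \<open>
  Write \<open>l\<close> for the length of \<open>R\<close> and \<open>(C)_j\<close> for the reductions of the \<open>u\<close> with \<open>\<pi>^j u\<close> in \<open>C\<close>.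
  If \<open>\<pi>^j v\<close> is orthogonal to \<open>C\<close> and \<open>\<pi>^(l-1-j) u\<close> lies in \<open>C\<close>, then \<open>\<pi>^(l-1) (u, v) = 0\<close>, so
  \<open>(u, v)\<close> lies in \<open>m\<close>. Conversely let \<open>v\<close> be orthogonal modulo \<open>m\<close> to \<open>(C)_(l-1-j)\<close>. Then
  \<open>\<pi>^j c + \<pi>^(l-1) u \<mapsto> \<pi>^(l-1) (u, v)\<close> is a well-defined linear functional on
  \<open>\<pi>^j C + \<pi>^(l-1) RG\<close>. As \<open>R\<close> is self-injective, it is the form with some \<open>w\<close>; this \<open>w\<close> has the
  same reduction as \<open>v\<close>, and \<open>\<pi>^j w\<close> is orthogonal to \<open>C\<close>.
\<close>

section \<open>Artinian chain rings with a chosen uniformizer\<close>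

locale uniformized_chain_ring = artinian_chain_ring R for R (structure) +
  fixes m \<pi>
  assumes maximal: "maximalideal m R"
    and pi_closed [simp]: "\<pi> \<in> carrier R"
    and m_eq: "m = PIdl \<pi>"
begin

abbreviation "len \<equiv> chain_ring_length R m"

section \<open>Units, nilpotency and powers of the maximal ideal\<close>

lemma mem_cgenideal: "x \<in> PIdl a \<longleftrightarrow> (\<exists>r\<in>carrier R. x = r \<otimes> a)"
  by (auto simp: cgenideal_def)

lemma cgenideal_mem_right: "a \<in> carrier R \<Longrightarrow> x \<in> PIdl a \<longleftrightarrow> (\<exists>r\<in>carrier R. x = a \<otimes> r)"
  by (auto simp: mem_cgenideal m_comm)

text \<open>The ideals \<open>PIdl x\<close> and \<open>m\<close> are comparable. As
  \<open>x\<close> lies outside \<open>m\<close>, the ideal \<open>PIdl x\<close> strictly contains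
  \<open>m\<close>, so maximality forces it to be the whole ring and \<open>\<one>\<close> is a
  multiple of \<open>x\<close>.\<close>

lemma unit_if_not_in_m:
  assumes "x \<in> carrier R" "x \<notin> m"
  shows "x \<in> Units R"
proof -
  interpret M: maximalideal m R by (rule maximal)
  have i: "ideal (PIdl x) R" using assms by (simp add: cgenideal_ideal)
  have x: "x \<in> PIdl x" using assms by (simp add: cgenideal_self)
  have "m \<subseteq> PIdl x" using chain[OF i M.is_ideal] x assms by blast
  then have "PIdl x = carrier R"
    using M.I_maximal[OF i] x assms ideal.Icarr[OF i] by blast
  then obtain r where "r \<in> carrier R" "\<one> = r \<otimes> x" by (metis mem_cgenideal one_closed)
  then show ?thesis using assms by (auto simp: Units_def m_comm intro!: bexI[of _ r])
qed

lemma pi_pow_mono: "i \<le> j \<Longrightarrow> \<pi> [^] i = \<zero> \<Longrightarrow> \<pi> [^] (j::nat) = \<zero>"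
  by (metis le_add_diff_inverse nat_pow_closed nat_pow_mult pi_closed l_null)

text \<open>The ideals generated by the powers of \<open>\<pi>\<close> descend, so they stabilize
  and some power satisfies \<open>\<pi> [^] n = r \<otimes> \<pi> [^] Suc n\<close>. The factor
  \<open>\<one> \<ominus> r \<otimes> \<pi>\<close> then kills \<open>\<pi> [^] n\<close>, and it is
  a unit.\<close>

lemma nilpotent: "\<exists>n::nat. \<pi> [^] n = \<zero>"
proof -
  interpret M: maximalideal m R by (rule maximal)
  have "\<exists>n. \<forall>k\<ge>n. PIdl (\<pi> [^] k) = PIdl (\<pi> [^] (n::nat))"
  proof (rule descending_chain_condition)
    fix n :: nat
    show "ideal (PIdl (\<pi> [^] n)) R" by (simp add: cgenideal_ideal)
    show "PIdl (\<pi> [^] Suc n) \<subseteq> PIdl (\<pi> [^] n)"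
    proof
      fix x assume "x \<in> PIdl (\<pi> [^] Suc n)"
      then obtain r where "r \<in> carrier R" "x = r \<otimes> (\<pi> \<otimes> \<pi> [^] n)"
        by (auto simp: mem_cgenideal m_comm)
      then show "x \<in> PIdl (\<pi> [^] n)"
        by (auto simp: mem_cgenideal m_assoc intro!: bexI[of _ "r \<otimes> \<pi>"])
    qed
  qed
  then obtain n :: nat where "PIdl (\<pi> [^] Suc n) = PIdl (\<pi> [^] n)" by (metis le_Suc_eq order_refl)
  then have "\<pi> [^] n \<in> PIdl (\<pi> [^] Suc n)" by (simp add: cgenideal_self)
  then obtain r where r: "r \<in> carrier R" "\<pi> [^] n = r \<otimes> (\<pi> [^] n \<otimes> \<pi>)"
    by (auto simp: mem_cgenideal)
  have "r \<otimes> \<pi> \<in> m" using r(1) by (auto simp: m_eq mem_cgenideal)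
  \<comment> \<open>Otherwise \<open>\<one>\<close>, the sum of this element and
    \<open>r \<otimes> \<pi>\<close>, would lie in \<open>m\<close>.\<close>
  have "\<one> \<ominus> r \<otimes> \<pi> \<notin> m"
  proof
    assume "\<one> \<ominus> r \<otimes> \<pi> \<in> m"
    then have "\<one> \<ominus> r \<otimes> \<pi> \<oplus> r \<otimes> \<pi> \<in> m" using \<open>r \<otimes> \<pi> \<in> m\<close> by (rule M.a_closed)
    also have "\<one> \<ominus> r \<otimes> \<pi> \<oplus> r \<otimes> \<pi> = \<one>" using r(1) by (simp add: minus_eq a_assoc l_neg)
    finally show False using M.I_notcarr M.one_imp_carrier by auto
  qed
  then have "\<one> \<ominus> r \<otimes> \<pi> \<in> Units R" using r(1) by (intro unit_if_not_in_m) auto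
  \<comment> \<open>The zero on the right is written with the same unit factor so that cancellation
    applies.\<close>
  moreover have "(\<one> \<ominus> r \<otimes> \<pi>) \<otimes> \<pi> [^] n = (\<one> \<ominus> r \<otimes> \<pi>) \<otimes> \<zero>"
  proof -
    have "(\<one> \<ominus> r \<otimes> \<pi>) \<otimes> p = p \<ominus> r \<otimes> (p \<otimes> \<pi>)" if "p \<in> carrier R" for p
      using that r(1) pi_closed by algebra
    from this[of "\<pi> [^] n"] show ?thesis using r by (simp add: minus_eq r_neg)
  qed
  ultimately have "\<pi> [^] n = \<zero>" by (subst (asm) Units_l_cancel) auto
  then show ?thesis ..
qed

text \<open>Ideal powers are formed in the monoid of ideals. Here they become principal, since a
  product of two principal ideals is generated by the product of the generators; questions about
  \<open>m\<close> turn into divisibility by powers of \<open>\<pi>\<close>.\<close>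

lemma ideal_power_eq: "ideal_power R m n = PIdl (\<pi> [^] n)"
proof (induction n)
  case 0
  have "PIdl \<one> = carrier R" using cgenideal_mem_right by auto
  then show ?case by (simp add: ideal_power_def ideals_set_def)
next
  case (Suc n)
  have "ideal_power R m (Suc n) = ideal_prod R (PIdl (\<pi> [^] n)) (PIdl \<pi>)"
    using Suc by (simp add: ideal_power_def m_eq) (simp add: ideals_set_def)
  also have "\<dots> = PIdl (\<pi> [^] n \<otimes> \<pi>)"
  proof
    show "PIdl (\<pi> [^] n \<otimes> \<pi>) \<subseteq> ideal_prod R (PIdl (\<pi> [^] n)) (PIdl \<pi>)"
    proof
      fix x assume "x \<in> PIdl (\<pi> [^] n \<otimes> \<pi>)"
      then obtain r where r: "r \<in> carrier R" "x = (r \<otimes> \<pi> [^] n) \<otimes> \<pi>"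
        by (auto simp: mem_cgenideal m_assoc)
      show "x \<in> ideal_prod R (PIdl (\<pi> [^] n)) (PIdl \<pi>)"
        unfolding r(2) by (rule ideal_prod.prod) (use r cgenideal_self[of \<pi>] in \<open>auto simp: mem_cgenideal\<close>)
    qed
    show "ideal_prod R (PIdl (\<pi> [^] n)) (PIdl \<pi>) \<subseteq> PIdl (\<pi> [^] n \<otimes> \<pi>)"
    proof
      fix x assume "x \<in> ideal_prod R (PIdl (\<pi> [^] n)) (PIdl \<pi>)"
      then show "x \<in> PIdl (\<pi> [^] n \<otimes> \<pi>)"
      proof induction
        case (prod i j)
        then obtain r s where rs: "r \<in> carrier R" "s \<in> carrier R" "i = r \<otimes> \<pi> [^] n" "j = s \<otimes> \<pi>"
          by (auto simp: mem_cgenideal)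
        then show ?case by (auto simp: mem_cgenideal m_ac intro!: bexI[of _ "r \<otimes> s"])
      next
        case (sum s1 s2)
        interpret I: ideal "PIdl (\<pi> [^] n \<otimes> \<pi>)" R by (simp add: cgenideal_ideal)
        show ?case using sum by (simp add: I.a_closed)
      qed
    qed
  qed
  finally show ?case by simp
qed

text \<open>By \<open>ideal_power_eq\<close> the length is the least exponent that annihilates
  \<open>\<pi>\<close>. Nilpotency ensures that this minimum is attained, and every larger exponent
  gives zero too.\<close>

lemma pi_pow_zero_iff: "\<pi> [^] n = \<zero> \<longleftrightarrow> len \<le> n"
proof -
  have "PIdl (\<pi> [^] n) = {\<zero>} \<longleftrightarrow> \<pi> [^] n = \<zero>" for n :: nat
  proof
    show "PIdl (\<pi> [^] n) = {\<zero>}" if "\<pi> [^] n = \<zero>"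
      using that genideal_zero by (simp add: cgenideal_eq_genideal)
    show "\<pi> [^] n = \<zero>" if "PIdl (\<pi> [^] n) = {\<zero>}"
      using that cgenideal_self[of "\<pi> [^] n"] by simp
  qed
  then have len: "len = (LEAST n::nat. \<pi> [^] n = \<zero>)"
    by (simp add: chain_ring_length_def ideal_power_eq)
  have "\<pi> [^] len = \<zero>" unfolding len using nilpotent by (rule LeastI_ex)
  then show ?thesis using pi_pow_mono[of len n] Least_le[of "\<lambda>n::nat. \<pi> [^] n = \<zero>" n] len by auto
qed

section \<open>Valuations and annihilators\<close>

text \<open>The exponent \<open>k\<close> is the valuation of \<open>x\<close>: the last index
  before \<open>x\<close> drops out of the descending chain of ideals
  \<open>PIdl (\<pi> [^] k)\<close>. If the cofactor \<open>u\<close> were in \<open>m\<close>, it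
  would contribute another factor \<open>\<pi>\<close>, against the choice of
  \<open>k\<close>.\<close>

lemma unit_factorization:
  assumes "x \<in> carrier R" "x \<noteq> \<zero>"
  obtains k u where "k < len" "u \<in> Units R" "x = \<pi> [^] k \<otimes> u"
proof -
  let ?P = "\<lambda>k::nat. x \<notin> PIdl (\<pi> [^] k)"
  have "?P len" using assms pi_pow_zero_iff[of len] by (simp add: mem_cgenideal)
  moreover have "\<not> ?P 0" using assms by (auto simp: mem_cgenideal)
  ultimately obtain k where k: "k < len" "\<not> ?P k" "?P (Suc k)"
    using ex_least_nat_less[of ?P len] by auto
  then obtain u where u: "u \<in> carrier R" "x = \<pi> [^] k \<otimes> u"
    by (auto simp: cgenideal_mem_right)
  have "u \<notin> m"
  proof
    assume "u \<in> m"
    then obtain r where "r \<in> carrier R" "u = r \<otimes> \<pi>" by (auto simp: m_eq mem_cgenideal)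
    then have "x \<in> PIdl (\<pi> [^] Suc k)"
      using u by (auto simp: mem_cgenideal m_ac intro!: bexI[of _ r])
    then show False using k by simp
  qed
  then show thesis using that k(1) u unit_if_not_in_m by blast
qed

text \<open>For nonzero \<open>r\<close> of valuation \<open>k\<close> the unit part cancels,
  leaving \<open>\<pi> [^] (a + k) = \<zero>\<close>, that is \<open>len \<le> a + k\<close>. This
  is the divisibility fact behind self-injectivity.\<close>

lemma annihilator_pi_pow:
  assumes "r \<in> carrier R" "a \<le> len" "\<pi> [^] a \<otimes> r = \<zero>"
  obtains s where "s \<in> carrier R" "r = \<pi> [^] (len - a) \<otimes> s"
proof (cases "r = \<zero>")
  case True
  then show thesis using that[of \<zero>] by simp
next
  case False
  then obtain k :: nat and u where ku: "u \<in> Units R" "r = \<pi> [^] k \<otimes> u"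
    using unit_factorization[OF assms(1)] by blast
  then have "u \<otimes> \<pi> [^] (a + k) = \<zero>"
    using assms(3) by (simp add: m_ac Units_closed flip: nat_pow_mult)
  then have "\<pi> [^] (a + k) = \<zero>" using ku(1) Units_l_cancel[of u _ \<zero>] by (simp add: Units_closed)
  then have le: "len - a \<le> k" by (simp add: pi_pow_zero_iff)
  show thesis
  proof (rule that)
    show "r = \<pi> [^] (len - a) \<otimes> (\<pi> [^] (k - (len - a)) \<otimes> u)"
      using ku le by (simp add: Units_closed nat_pow_mult flip: m_assoc)
  qed (use ku in auto)
qed

text \<open>Below the length, division by \<open>\<pi> [^] j\<close> is well defined modulo
  \<open>m\<close>: if \<open>\<pi> [^] j\<close> kills
  \<open>r \<ominus> s \<otimes> \<pi>\<close>, that difference is a multiple of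
  \<open>\<pi> [^] (len - j)\<close>.\<close>

lemma in_m_if_pi_pow_mult:
  assumes "r \<in> carrier R" "j < len" "\<pi> [^] j \<otimes> r \<in> PIdl (\<pi> [^] Suc j)"
  shows "r \<in> m"
proof -
  obtain s where s: "s \<in> carrier R" "\<pi> [^] j \<otimes> r = s \<otimes> (\<pi> [^] j \<otimes> \<pi>)"
    using assms(3) by (auto simp: mem_cgenideal)
  have "\<pi> [^] j \<otimes> (r \<ominus> s \<otimes> \<pi>) = \<pi> [^] j \<otimes> r \<ominus> s \<otimes> (\<pi> [^] j \<otimes> \<pi>)"
  proof -
    have "p \<otimes> (r \<ominus> s \<otimes> \<pi>) = p \<otimes> r \<ominus> s \<otimes> (p \<otimes> \<pi>)" if "p \<in> carrier R" for p
      using that s(1) assms(1) pi_closed by algebra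
    then show ?thesis by simp
  qed
  also have "\<dots> = \<zero>" using s by (simp add: minus_eq r_neg)
  finally obtain t where t: "t \<in> carrier R" "r \<ominus> s \<otimes> \<pi> = \<pi> [^] (len - j) \<otimes> t"
    using annihilator_pi_pow[of "r \<ominus> s \<otimes> \<pi>" j] s(1) assms by auto
  \<comment> \<open>Since \<open>j < len\<close>, the exponent \<open>len - j\<close> is positive,
    so the annihilated difference still contains a factor \<open>\<pi>\<close>.\<close>
  obtain k where "len - j = Suc k" using assms(2) by (metis Suc_diff_Suc)
  then have "r = (s \<oplus> \<pi> [^] k \<otimes> t) \<otimes> \<pi>"
  proof -
    have "r = s \<otimes> \<pi> \<oplus> (r \<ominus> s \<otimes> \<pi>)" using s(1) assms(1) pi_closed by algebra
    also have "\<dots> = s \<otimes> \<pi> \<oplus> \<pi> [^] k \<otimes> \<pi> \<otimes> t" using t \<open>len - j = Suc k\<close> by simp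
    also have "\<dots> = (s \<oplus> \<pi> [^] k \<otimes> t) \<otimes> \<pi>" using s(1) t(1) by (simp add: l_distr r_distr m_ac)
    finally show ?thesis .
  qed
  then show ?thesis using s t by (auto simp: m_eq mem_cgenideal)
qed

text \<open>Multiplication by \<open>\<pi> [^] (len - 1)\<close> embeds the residue field into
  \<open>R\<close>, so a congruence modulo \<open>m\<close> can be tested as an equation in
  \<open>R\<close>.\<close>

lemma pi_pow_times_eq_zero_iff:
  assumes "r \<in> carrier R" "0 < len"
  shows "\<pi> [^] (len - 1) \<otimes> r = \<zero> \<longleftrightarrow> r \<in> m"
proof
  assume "\<pi> [^] (len - 1) \<otimes> r = \<zero>"
  then show "r \<in> m"
    using assms by (intro in_m_if_pi_pow_mult[of r "len - 1"]) (auto simp: mem_cgenideal intro: bexI[of _ \<zero>])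
next
  assume "r \<in> m"
  then obtain s where "s \<in> carrier R" "r = \<pi> \<otimes> s" by (auto simp: m_eq cgenideal_mem_right)
  then have "\<pi> [^] (len - 1) \<otimes> r = \<pi> [^] Suc (len - 1) \<otimes> s" by (simp add: m_assoc)
  also have "\<dots> = \<zero>"
    using assms(2) pi_pow_zero_iff[of "Suc (len - 1)"] \<open>s \<in> carrier R\<close> by simp
  finally show "\<pi> [^] (len - 1) \<otimes> r = \<zero>" .
qed

text \<open>Self-injectivity of the ring: \<open>F\<close> is the graph of a linear map on a submodule of a free
  module that factors through the coordinates in \<open>I\<close>, and this map is extended to the whole module.\<close>

lemma functional_extension:
  fixes F :: "(('i \<Rightarrow> 'a) \<times> 'a) set"
  assumes "finite I" "I \<subseteq> J"
    and "\<And>x y i. (x, y) \<in> F \<Longrightarrow> i \<in> J \<Longrightarrow> x i \<in> carrier R"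
    and "\<And>x y. (x, y) \<in> F \<Longrightarrow> y \<in> carrier R"
    and "\<And>x y x' y'. (x, y) \<in> F \<Longrightarrow> (x', y') \<in> F \<Longrightarrow> (\<lambda>i\<in>J. x i \<oplus> x' i, y \<oplus> y') \<in> F"
    and "\<And>r x y. r \<in> carrier R \<Longrightarrow> (x, y) \<in> F \<Longrightarrow> (\<lambda>i\<in>J. r \<otimes> x i, r \<otimes> y) \<in> F"
    and "\<And>x y. (x, y) \<in> F \<Longrightarrow> (\<And>i. i \<in> I \<Longrightarrow> x i = \<zero>) \<Longrightarrow> y = \<zero>"
  shows "\<exists>w \<in> I \<rightarrow> carrier R. \<forall>(x, y)\<in>F. y = (\<Oplus>i\<in>I. x i \<otimes> w i)"
  using assms
proof (induction I arbitrary: F rule: finite_induct)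
  case empty
  then show ?case by auto
next
  case (insert i I)
  note carrier = insert.prems(2,3) and add = insert.prems(4) and smult = insert.prems(5)
    and kernel = insert.prems(6)
  have iJ: "i \<in> J" and IJ: "I \<subseteq> J" using insert.prems(1) by auto
  \<comment> \<open>On \<open>F0\<close> the coordinates in \<open>I\<close> vanish, so the
    functional depends on the coordinate \<open>i\<close> alone. The first task is to realize it
    there as multiplication by one scalar \<open>z\<close>.\<close>
  define F0 where "F0 = {(x, y) \<in> F. \<forall>k\<in>I. x k = \<zero>}"
  have "\<exists>z\<in>carrier R. \<forall>(x, y)\<in>F0. y = x i \<otimes> z"
  proof (cases "\<forall>(x, y)\<in>F0. x i = \<zero>")
    case True
    then have "\<forall>(x, y)\<in>F0. y = x i \<otimes> \<zero>" using kernel by (fastforce simp: F0_def)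
    then show ?thesis by blast
  next
    case False
    \<comment> \<open>The \<open>i\<close>-th coordinates of \<open>F0\<close> are closed under sums
      and scalar multiples; an entry of least valuation \<open>k\<close> divides all the
      others.\<close>
    let ?P = "\<lambda>k. k \<le> len \<and> (\<exists>x y u. (x, y) \<in> F0 \<and> u \<in> Units R \<and> x i = \<pi> [^] k \<otimes> u)"
    obtain x y where xy: "(x, y) \<in> F0" "x i \<noteq> \<zero>" using False by auto
    then have "x i \<in> carrier R" using carrier(1) iJ by (auto simp: F0_def)
    then obtain k u where "k < len" "u \<in> Units R" "x i = \<pi> [^] k \<otimes> u"
      using xy(2) unit_factorization by blast
    then have "\<exists>k. ?P k" using xy(1) by (metis less_imp_le)
    define k where "k = (LEAST k. ?P k)"
    have "?P k" unfolding k_def by (rule LeastI_ex) fact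
    then obtain x0 y0 u where x0: "k \<le> len" "(x0, y0) \<in> F0" "u \<in> Units R" "x0 i = \<pi> [^] k \<otimes> u"
      by auto
    then have F0: "(x0, y0) \<in> F" and x0I: "\<And>j. j \<in> I \<Longrightarrow> x0 j = \<zero>" and y0: "y0 \<in> carrier R"
      using carrier(2) by (auto simp: F0_def)
    \<comment> \<open>Scaling by \<open>\<pi> [^] (len - k)\<close> kills \<open>x0 i\<close> and
      keeps the zeros on \<open>I\<close>, so the kernel hypothesis kills the scaled value. As
      \<open>len - (len - k) = k\<close>, this makes \<open>y0\<close> divisible by
      \<open>\<pi> [^] k\<close>.\<close>
    have "\<pi> [^] (len - k) \<otimes> y0 = \<zero>"
    proof (rule kernel[OF smult[OF _ F0]])
      fix j assume j: "j \<in> insert i I"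
      have "\<pi> [^] (len - k) \<otimes> x0 i = \<pi> [^] len \<otimes> u"
        using x0 by (simp add: Units_closed nat_pow_mult flip: m_assoc)
      also have "\<dots> = \<zero>" using x0(3) pi_pow_zero_iff[of len] by (simp add: Units_closed)
      finally show "(\<lambda>j\<in>J. \<pi> [^] (len - k) \<otimes> x0 j) j = \<zero>"
        using j iJ IJ x0I by auto
    qed simp
    then obtain s where s: "s \<in> carrier R" "y0 = \<pi> [^] k \<otimes> s"
      using annihilator_pi_pow[of y0 "len - k"] y0 x0(1) by auto
    \<comment> \<open>The scalar \<open>inv u \<otimes> s\<close> is the quotient of
      \<open>y0 = \<pi> [^] k \<otimes> s\<close> by \<open>x0 i = \<pi> [^] k \<otimes> u\<close>.
      It works on all of \<open>F0\<close> because each pair there has the same value as a multiple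
      of \<open>(x0, y0)\<close>.\<close>
    have *: "y = x i \<otimes> (inv u \<otimes> s)" if "(x, y) \<in> F0" for x y
    proof -
      have xyF: "(x, y) \<in> F" and xI: "\<And>j. j \<in> I \<Longrightarrow> x j = \<zero>" using that by (auto simp: F0_def)
      have xy: "x i \<in> carrier R" "y \<in> carrier R" using carrier xyF iJ by auto
      obtain r where r: "r \<in> carrier R" "x i = r \<otimes> x0 i"
      proof (cases "x i = \<zero>")
        case True
        then show thesis using that[of \<zero>] x0 by (simp add: Units_closed)
      next
        case False
        then obtain k' u' where k': "k' < len" "u' \<in> Units R" "x i = \<pi> [^] k' \<otimes> u'"
          using unit_factorization[OF xy(1)] by blast
        then have "?P k'" using \<open>(x, y) \<in> F0\<close> by (intro conjI) auto
        then have "k \<le> k'" unfolding k_def by (rule Least_le)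
        \<comment> \<open>The multiplier is the quotient of \<open>\<pi> [^] k' \<otimes> u'\<close>
          by \<open>\<pi> [^] k \<otimes> u\<close>, which exists because \<open>k\<close> is
          minimal.\<close>
        have "(\<pi> [^] (k' - k) \<otimes> u' \<otimes> inv u) \<otimes> x0 i
            = (\<pi> [^] (k' - k) \<otimes> \<pi> [^] k) \<otimes> u' \<otimes> (inv u \<otimes> u)"
        proof -
          have "(q \<otimes> v \<otimes> a) \<otimes> (p \<otimes> b) = (q \<otimes> p) \<otimes> v \<otimes> (a \<otimes> b)"
            if "q \<in> carrier R" "p \<in> carrier R" "v \<in> carrier R" "a \<in> carrier R" "b \<in> carrier R"
            for q p v a b
            using that by (simp add: m_ac)
          from this[of "\<pi> [^] (k' - k)" "\<pi> [^] k" u' "inv u" u] show ?thesis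
            using k' x0 by (simp only: Units_closed Units_inv_closed nat_pow_closed pi_closed)
        qed
        also have "\<dots> = x i" using k' x0 \<open>k \<le> k'\<close> by (simp add: Units_closed nat_pow_mult)
        finally show thesis using k' x0
          by (intro that[of "\<pi> [^] (k' - k) \<otimes> u' \<otimes> inv u"]) (auto simp: Units_closed)
      qed
      \<comment> \<open>Subtracting the \<open>r\<close>-fold multiple of \<open>(x0, y0)\<close>
        clears the coordinate \<open>i\<close> as well as those in \<open>I\<close>, so the value of
        the difference must be zero.\<close>
      have "(\<lambda>j\<in>J. x j \<oplus> (\<lambda>j\<in>J. \<ominus> r \<otimes> x0 j) j, y \<oplus> \<ominus> r \<otimes> y0) \<in> F"
        using r by (intro add[OF xyF smult[OF _ F0]]) simp
      then have "y \<oplus> \<ominus> r \<otimes> y0 = \<zero>"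
      proof (rule kernel)
        fix j assume j: "j \<in> insert i I"
        have "x0 i \<in> carrier R" using carrier(1)[OF F0 iJ] .
        then show "(\<lambda>j\<in>J. x j \<oplus> (\<lambda>j\<in>J. \<ominus> r \<otimes> x0 j) j) j = \<zero>"
          using j iJ IJ x0I xI r by (auto simp: l_minus r_neg)
      qed
      then have "y = r \<otimes> y0"
        using minus_equality[of y "\<ominus> r \<otimes> y0"] r(1) xy(2) y0 by (simp add: l_minus)
      also have "\<dots> = (r \<otimes> x0 i) \<otimes> (inv u \<otimes> s)"
      proof -
        have "(r \<otimes> (p \<otimes> a)) \<otimes> (b \<otimes> s) = r \<otimes> (p \<otimes> s) \<otimes> (b \<otimes> a)"
          if "p \<in> carrier R" "a \<in> carrier R" "b \<in> carrier R" for p a b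
          using that r(1) s(1) by (simp add: m_ac)
        then have "(r \<otimes> x0 i) \<otimes> (inv u \<otimes> s) = r \<otimes> (\<pi> [^] k \<otimes> s) \<otimes> (inv u \<otimes> u)"
          using x0(3,4) by (simp add: Units_closed)
        then show ?thesis using s r(1) x0(3) by simp
      qed
      finally show ?thesis using r(2) by simp
    qed
    then show ?thesis using s x0(3) by (intro bexI[of _ "inv u \<otimes> s"]) auto
  qed
  then obtain z where z: "z \<in> carrier R" "\<And>x y. (x, y) \<in> F0 \<Longrightarrow> y = x i \<otimes> z" by auto
  \<comment> \<open>Removing the contribution of the coordinate \<open>i\<close> leaves a functional
    that vanishes whenever the coordinates in \<open>I\<close> do, which is the hypothesis for
    induction.\<close>
  define F' where "F' = (\<lambda>(x, y). (x, y \<ominus> x i \<otimes> z)) ` F"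
  have "\<exists>w\<in>I \<rightarrow> carrier R. \<forall>(x, y)\<in>F'. y = (\<Oplus>j\<in>I. x j \<otimes> w j)"
  proof (rule insert.IH)
    show "I \<subseteq> J" by fact
    show "x j \<in> carrier R" if "(x, y) \<in> F'" "j \<in> J" for x y j
      using that carrier(1) by (auto simp: F'_def)
    show "y \<in> carrier R" if "(x, y) \<in> F'" for x y
      using that carrier iJ z(1) by (fastforce simp: F'_def)
    show "(\<lambda>i\<in>J. x i \<oplus> x' i, y \<oplus> y') \<in> F'" if F': "(x, y) \<in> F'" "(x', y') \<in> F'" for x y x' y'
    proof -
      obtain v v' where v: "(x, v) \<in> F" "y = v \<ominus> x i \<otimes> z" "(x', v') \<in> F" "y' = v' \<ominus> x' i \<otimes> z"
        using F' by (auto simp: F'_def)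
      then have "v \<in> carrier R" "v' \<in> carrier R" "x i \<in> carrier R" "x' i \<in> carrier R"
        using carrier iJ by auto
      then have "y \<oplus> y' = (v \<oplus> v') \<ominus> (x i \<oplus> x' i) \<otimes> z" using v(2,4) z(1) by algebra
      then show ?thesis using add[OF v(1,3)] iJ by (force simp: F'_def)
    qed
    show "(\<lambda>i\<in>J. r \<otimes> x i, r \<otimes> y) \<in> F'" if r: "r \<in> carrier R" and F': "(x, y) \<in> F'" for r x y
    proof -
      obtain v where v: "(x, v) \<in> F" "y = v \<ominus> x i \<otimes> z" using F' by (auto simp: F'_def)
      then have "v \<in> carrier R" "x i \<in> carrier R" using carrier iJ by auto
      then have "r \<otimes> y = r \<otimes> v \<ominus> r \<otimes> x i \<otimes> z" using v(2) z(1) r by algebra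
      then show ?thesis using smult[OF r v(1)] iJ by (force simp: F'_def)
    qed
    show "y = \<zero>" if F': "(x, y) \<in> F'" and xI: "\<And>j. j \<in> I \<Longrightarrow> x j = \<zero>" for x y
    proof -
      obtain v where v: "(x, v) \<in> F" "y = v \<ominus> x i \<otimes> z" using F' by (auto simp: F'_def)
      then have "v = x i \<otimes> z" using xI by (intro z(2)) (auto simp: F0_def)
      moreover have "v \<in> carrier R" using v carrier by auto
      ultimately show ?thesis using v(2) by (simp add: minus_eq r_neg)
    qed
  qed
  then obtain w where w: "w \<in> I \<rightarrow> carrier R" and "\<forall>(x, y)\<in>F'. y = (\<Oplus>j\<in>I. x j \<otimes> w j)" ..
  then have w_F': "y = (\<Oplus>j\<in>I. x j \<otimes> w j)" if "(x, y) \<in> F'" for x y using that by auto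
  \<comment> \<open>As \<open>i\<close> is not in \<open>I\<close>, changing \<open>w\<close> at
    \<open>i\<close> does not affect the sum over \<open>I\<close>; the new term restores what was
    subtracted in \<open>F'\<close>.\<close>
  have "y = (\<Oplus>j\<in>insert i I. x j \<otimes> (w(i := z)) j)" if F: "(x, y) \<in> F" for x y
  proof -
    have x: "x j \<in> carrier R" if "j \<in> J" for j using carrier F that by auto
    have y: "y \<in> carrier R" using carrier F by auto
    have xI: "x j \<in> carrier R" "w j \<in> carrier R" if "j \<in> I" for j using x w IJ that by auto
    have "(\<Oplus>j\<in>I. x j \<otimes> (w(i := z)) j) = (\<Oplus>j\<in>I. x j \<otimes> w j)"
      using xI insert.hyps by (intro finsum_cong') auto
    also have "\<dots> = y \<ominus> x i \<otimes> z"
    proof (rule w_F'[symmetric])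
      show "(x, y \<ominus> x i \<otimes> z) \<in> F'" unfolding F'_def using F by force
    qed
    finally have "(\<Oplus>j\<in>insert i I. x j \<otimes> (w(i := z)) j) = x i \<otimes> z \<oplus> (y \<ominus> x i \<otimes> z)"
      using insert.hyps xI x z(1) iJ by (subst finsum_insert) auto
    also have "\<dots> = y" using x[OF iJ] y z(1) by algebra
    finally show ?thesis ..
  qed
  moreover have "w(i := z) \<in> insert i I \<rightarrow> carrier R" using w z(1) by auto
  ultimately show ?case by blast
qed

end

section \<open>The chain of a code\<close>

locale chain_group_ring =
  group_ring_setup R G + uniformized_chain_ring R m \<pi>
  for R :: "('a, 'b) ring_scheme" (structure) and m \<pi> and G :: "('g, 'c) monoid_scheme"
begin

section \<open>Coefficients, scalars and bilinearity of the form\<close>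

lemma coeff_closed: "v \<in> carrier RG \<Longrightarrow> g \<in> carrier G \<Longrightarrow> v g \<in> carrier R"
  by (auto simp: RG_carrier)

lemma smult_apply: "g \<in> carrier G \<Longrightarrow> (r \<odot>\<^bsub>RG\<^esub> v) g = r \<otimes> v g"
  and add_apply: "g \<in> carrier G \<Longrightarrow> (u \<oplus>\<^bsub>RG\<^esub> v) g = u g \<oplus> v g"
  and zero_apply: "g \<in> carrier G \<Longrightarrow> \<zero>\<^bsub>RG\<^esub> g = \<zero>"
  by (simp_all add: group_ring_def)

lemma smult_closed: "r \<in> carrier R \<Longrightarrow> v \<in> carrier RG \<Longrightarrow> r \<odot>\<^bsub>RG\<^esub> v \<in> carrier RG"
  by (auto simp: group_ring_def)

lemma carrier_eqI:
  "u \<in> carrier RG \<Longrightarrow> v \<in> carrier RG \<Longrightarrow> (\<And>g. g \<in> carrier G \<Longrightarrow> u g = v g) \<Longrightarrow> u = v"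
  by (rule fun_eqI) (auto simp: RG_carrier PiE_def)

text \<open>Left ideals are closed under multiplication by ring elements of \<open>RG\<close>.
  Writing scalars as such elements makes every group code closed under scalar
  multiplication.\<close>

lemma smult_eq_emb_mult:
  assumes "r \<in> carrier R" "v \<in> carrier RG"
  shows "r \<odot>\<^bsub>RG\<^esub> v = emb r \<otimes>\<^bsub>RG\<^esub> v"
proof -
  interpret RG: ring RG by (rule ring_RG)
  show ?thesis using assms
    by (intro carrier_eqI) (auto simp: smult_closed smult_apply emb_mult)
qed

lemma form_closed:
  "u \<in> carrier RG \<Longrightarrow> v \<in> carrier RG \<Longrightarrow> code_form R G u v \<in> carrier R"
  unfolding code_form_def by (auto intro!: finsum_closed simp: coeff_closed)

lemma form_add_left:
  assumes "u \<in> carrier RG" "u' \<in> carrier RG" "v \<in> carrier RG"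
  shows "code_form R G (u \<oplus>\<^bsub>RG\<^esub> u') v = code_form R G u v \<oplus> code_form R G u' v"
proof -
  have "code_form R G (u \<oplus>\<^bsub>RG\<^esub> u') v = (\<Oplus>g\<in>carrier G. u g \<otimes> v g \<oplus> u' g \<otimes> v g)"
    unfolding code_form_def using assms
    by (intro finsum_cong') (auto simp: add_apply coeff_closed l_distr)
  also have "\<dots> = code_form R G u v \<oplus> code_form R G u' v"
    unfolding code_form_def using assms by (intro finsum_addf) (auto simp: coeff_closed)
  finally show ?thesis .
qed

lemma form_smult_left:
  assumes "r \<in> carrier R" "u \<in> carrier RG" "v \<in> carrier RG"
  shows "code_form R G (r \<odot>\<^bsub>RG\<^esub> u) v = r \<otimes> code_form R G u v"
proof -
  have "code_form R G (r \<odot>\<^bsub>RG\<^esub> u) v = (\<Oplus>g\<in>carrier G. r \<otimes> (u g \<otimes> v g))"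
    unfolding code_form_def using assms
    by (intro finsum_cong') (auto simp: smult_apply coeff_closed R.m_assoc)
  also have "\<dots> = r \<otimes> code_form R G u v"
    unfolding code_form_def using assms by (intro finsum_rdistr[symmetric]) (auto simp: coeff_closed)
  finally show ?thesis .
qed

lemma form_commute:
  assumes "u \<in> carrier RG" "v \<in> carrier RG"
  shows "code_form R G u v = code_form R G v u"
  unfolding code_form_def using assms by (intro finsum_cong') (auto simp: coeff_closed m_comm)

lemma form_smult_right:
  assumes "r \<in> carrier R" "u \<in> carrier RG" "v \<in> carrier RG"
  shows "code_form R G u (r \<odot>\<^bsub>RG\<^esub> v) = r \<otimes> code_form R G u v"
  using assms by (simp add: form_commute[of u] form_smult_left smult_closed)

text \<open>Pairing with the group basis recovers coefficients, so vectors can be compared through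
  the form.\<close>

lemma form_delta_left:
  assumes "g \<in> carrier G" "v \<in> carrier RG"
  shows "code_form R G (delta g) v = v g"
proof -
  have "code_form R G (delta g) v = (\<Oplus>h\<in>carrier G. if h = g then v g else \<zero>)"
    unfolding code_form_def using assms
    by (intro finsum_cong') (auto simp: delta_apply coeff_closed)
  also have "\<dots> = v g"
    using assms by (intro finsum_single) (auto simp: coeff_closed abelian_monoid_axioms)
  finally show ?thesis .
qed

lemma form_zero_left:
  assumes "v \<in> carrier RG"
  shows "code_form R G \<zero>\<^bsub>RG\<^esub> v = \<zero>"
proof -
  have "code_form R G \<zero>\<^bsub>RG\<^esub> v = (\<Oplus>g\<in>carrier G. \<zero>)"
    unfolding code_form_def using assms by (intro finsum_cong') (auto simp: zero_apply coeff_closed)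
  then show ?thesis by (simp add: finsum_zero)
qed

section \<open>The filtration by powers of the maximal ideal\<close>

text \<open>The generated subgroup has two concrete descriptions because \<open>m\<close> is
  principal: every coefficient is divisible by \<open>\<pi> [^] j\<close>, and the quotients
  assemble into one vector \<open>y\<close>, so sums of generators collapse to a single one.\<close>

lemma mem_filtration:
  "x \<in> filtration R G m j \<longleftrightarrow> x \<in> carrier RG \<and> (\<forall>g\<in>carrier G. x g \<in> PIdl (\<pi> [^] j))"
  and mem_filtration_smult:
  "x \<in> filtration R G m j \<longleftrightarrow> (\<exists>y\<in>carrier RG. x = \<pi> [^] j \<odot>\<^bsub>RG\<^esub> y)"
proof -
  interpret RG: ring RG by (rule ring_RG)
  interpret I: ideal "PIdl (\<pi> [^] j)" R by (simp add: cgenideal_ideal)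
  define B where "B = {x \<in> carrier RG. \<forall>g\<in>carrier G. x g \<in> PIdl (\<pi> [^] j)}"
  let ?S = "{a \<odot>\<^bsub>RG\<^esub> x | a x. a \<in> PIdl (\<pi> [^] j) \<and> x \<in> carrier RG}"
  have fil: "filtration R G m j = generate (add_monoid RG) ?S"
    by (simp add: ideal_smult_def ideal_power_eq)
  have "subgroup B (add_monoid RG)"
  proof (rule group.subgroupI[OF RG.a_group])
    show "B \<noteq> {}" using I.zero_closed by (auto simp: B_def zero_apply intro!: exI[of _ "\<zero>\<^bsub>RG\<^esub>"])
    show "inv\<^bsub>add_monoid RG\<^esub> x \<in> B" if x: "x \<in> B" for x
    proof -
      have c: "\<ominus>\<^bsub>RG\<^esub> x \<in> carrier RG" "x \<in> carrier RG" using x by (auto simp: B_def)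
      have "(\<ominus>\<^bsub>RG\<^esub> x) g \<in> PIdl (\<pi> [^] j)" if g: "g \<in> carrier G" for g
      proof -
        have "(\<ominus>\<^bsub>RG\<^esub> x) g \<oplus> x g = \<zero>"
          using add_apply[OF g, of "\<ominus>\<^bsub>RG\<^esub> x" x] c g by (simp add: RG.l_neg zero_apply)
        then have "(\<ominus>\<^bsub>RG\<^esub> x) g = \<ominus> x g"
          using c g by (intro minus_equality[symmetric]) (auto simp: coeff_closed)
        then show ?thesis using x g by (simp add: B_def I.a_inv_closed)
      qed
      then show ?thesis using c by (simp add: B_def flip: a_inv_def)
    qed
  qed (auto simp: B_def add_apply I.a_closed)
  moreover have "?S \<subseteq> B"
  proof clarify
    fix a x assume a: "a \<in> PIdl (\<pi> [^] j)" and x: "x \<in> carrier RG"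
    have "a \<otimes> x g \<in> PIdl (\<pi> [^] j)" if "g \<in> carrier G" for g
      using a coeff_closed[OF x that] by (rule I.I_r_closed)
    then show "a \<odot>\<^bsub>RG\<^esub> x \<in> B"
      using x I.Icarr[OF a] by (simp add: B_def smult_apply smult_closed)
  qed
  ultimately have 1: "filtration R G m j \<subseteq> B"
    unfolding fil by (intro group.generate_subgroup_incl[OF RG.a_group])
  \<comment> \<open>The vector \<open>y\<close> is chosen coefficientwise and then restricted to the
    group to make it an element of \<open>RG\<close>.\<close>
  have 2: "\<exists>y\<in>carrier RG. x = \<pi> [^] j \<odot>\<^bsub>RG\<^esub> y" if x: "x \<in> B" for x
  proof -
    have "\<forall>g\<in>carrier G. \<exists>r. r \<in> carrier R \<and> x g = \<pi> [^] j \<otimes> r"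
    proof
      fix g assume "g \<in> carrier G"
      then have "x g \<in> PIdl (\<pi> [^] j)" using x by (simp add: B_def)
      then show "\<exists>r. r \<in> carrier R \<and> x g = \<pi> [^] j \<otimes> r"
        using cgenideal_mem_right[of "\<pi> [^] j" "x g"] by (auto simp only: R.nat_pow_closed pi_closed)
    qed
    then obtain y where y: "\<forall>g\<in>carrier G. y g \<in> carrier R \<and> x g = \<pi> [^] j \<otimes> y g"
      by (rule bchoice[THEN exE])
    then have "restrict y (carrier G) \<in> carrier RG" by (simp add: RG_carrier)
    moreover from this have "x = \<pi> [^] j \<odot>\<^bsub>RG\<^esub> restrict y (carrier G)"
      using x y by (intro carrier_eqI) (auto simp: B_def smult_apply smult_closed)
    ultimately show ?thesis by blast
  qed
  have 3: "\<pi> [^] j \<odot>\<^bsub>RG\<^esub> y \<in> filtration R G m j" if "y \<in> carrier RG" for y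
    unfolding fil using that cgenideal_self[of "\<pi> [^] j"] by (intro generate.incl) auto
  have fil_B: "filtration R G m j = B"
  proof
    show "B \<subseteq> filtration R G m j"
    proof
      fix x assume "x \<in> B"
      then obtain y where "y \<in> carrier RG" "x = \<pi> [^] j \<odot>\<^bsub>RG\<^esub> y" using 2 by blast
      then show "x \<in> filtration R G m j" using 3 by simp
    qed
  qed (rule 1)
  show "x \<in> filtration R G m j \<longleftrightarrow> x \<in> carrier RG \<and> (\<forall>g\<in>carrier G. x g \<in> PIdl (\<pi> [^] j))"
    using fil_B by (simp add: B_def)
  show "x \<in> filtration R G m j \<longleftrightarrow> (\<exists>y\<in>carrier RG. x = \<pi> [^] j \<odot>\<^bsub>RG\<^esub> y)"
    using 2[of x] 3 fil_B by auto
qed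

section \<open>Reduction to the residue field\<close>

definition reduction :: "('g \<Rightarrow> 'a) \<Rightarrow> 'g \<Rightarrow> 'a set"
  where "reduction u = (\<lambda>g\<in>carrier G. m +> u g)"

lemma ideal_m: "ideal m R"
  using maximal by (rule maximalideal.axioms)

lemma reduction_eq_iff:
  assumes "u \<in> carrier RG" "v \<in> carrier RG"
  shows "reduction u = reduction v \<longleftrightarrow> (\<forall>g\<in>carrier G. u g \<ominus> v g \<in> m)"
  using assms quotient_eq_iff_same_a_r_cos[OF ideal_m]
  by (auto simp: reduction_def fun_eq_iff restrict_def coeff_closed)

text \<open>Choosing a representative of each coefficient lifts any vector over the residue field.
  This lets a dual code there be computed with vectors of \<open>RG\<close>.\<close>

lemma image_reduction: "reduction ` carrier RG = carrier (group_ring (R Quot m) G)"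
proof -
  have Q: "carrier (group_ring (R Quot m) G) = carrier G \<rightarrow>\<^sub>E carrier (R Quot m)"
    by (simp add: group_ring_def)
  have C: "carrier (R Quot m) = (\<lambda>r. m +> r) ` carrier R" by (auto simp: FactRing_simps)
  show ?thesis
  proof
    show "reduction ` carrier RG \<subseteq> carrier (group_ring (R Quot m) G)"
      by (auto simp: Q C reduction_def coeff_closed)
    show "carrier (group_ring (R Quot m) G) \<subseteq> reduction ` carrier RG"
    proof
      fix w assume w: "w \<in> carrier (group_ring (R Quot m) G)"
      then have "\<forall>g\<in>carrier G. \<exists>r. r \<in> carrier R \<and> w g = m +> r"
        by (auto simp: Q C PiE_iff)
      then obtain v where v: "\<forall>g\<in>carrier G. v g \<in> carrier R \<and> w g = m +> v g"
        by (rule bchoice[THEN exE])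
      have "w = reduction (restrict v (carrier G))"
        using w v by (intro fun_eqI) (auto simp: Q reduction_def PiE_iff)
      then show "w \<in> reduction ` carrier RG" using v by (auto simp: RG_carrier)
    qed
  qed
qed

lemma code_form_reduction:
  assumes "u \<in> carrier RG" "v \<in> carrier RG"
  shows "code_form (R Quot m) G (reduction u) (reduction v) = m +> code_form R G u v"
proof -
  interpret h: ring_hom_cring R "R Quot m" "(+>) m"
    using ideal.rcos_ring_hom_cring[OF ideal_m] is_cring .
  have "m +> code_form R G u v = (\<Oplus>\<^bsub>R Quot m\<^esub>g\<in>carrier G. m +> (u g \<otimes> v g))"
    unfolding code_form_def using assms by (subst h.hom_finsum) (auto simp: coeff_closed comp_def)
  also have "\<dots> = code_form (R Quot m) G (reduction u) (reduction v)"
    unfolding code_form_def using assms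
    by (intro h.S.finsum_cong') (auto simp: coeff_closed reduction_def)
  finally show ?thesis ..
qed

text \<open>The form commutes with reduction, so being orthogonal over the residue field means that
  the form of the lifts lies in \<open>m\<close>. With surjectivity of reduction this moves the dual
  back to \<open>RG\<close>.\<close>

lemma dual_code_reduction:
  assumes "D \<subseteq> carrier RG"
  shows "dual_code (R Quot m) G (reduction ` D)
    = reduction ` {v \<in> carrier RG. \<forall>u\<in>D. code_form R G u v \<in> m}"
proof -
  have "m +> r = m \<longleftrightarrow> r \<in> m" if "r \<in> carrier R" for r
    using that ideal.rcos_const_imp_mem[OF ideal_m] a_rcos_zero[OF ideal_m] by blast
  then have *: "code_form (R Quot m) G (reduction u) (reduction v) = \<zero>\<^bsub>R Quot m\<^esub>
      \<longleftrightarrow> code_form R G u v \<in> m" if "u \<in> D" "v \<in> carrier RG" for u v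
  proof -
    have "u \<in> carrier RG" using that assms by auto
    moreover have "\<zero>\<^bsub>R Quot m\<^esub> = m" by (simp add: FactRing_def)
    ultimately show ?thesis using that code_form_reduction form_closed \<open>\<And>r. r \<in> carrier R \<Longrightarrow> (m +> r = m) = (r \<in> m)\<close> by simp
  qed
  show ?thesis
    unfolding dual_code_def image_reduction[symmetric] using * by (auto simp: image_iff)
qed

section \<open>The chain expressed by reductions\<close>

lemma coset_coefficient:
  assumes c: "c \<in> carrier RG" and g: "g \<in> carrier G"
  shows "(\<lambda>w. w g) ` (filtration R G m j +>\<^bsub>RG\<^esub> c) = PIdl (\<pi> [^] j) +> c g"
proof
  show "(\<lambda>w. w g) ` (filtration R G m j +>\<^bsub>RG\<^esub> c) \<subseteq> PIdl (\<pi> [^] j) +> c g"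
    using g by (auto simp: a_r_coset_def' mem_filtration add_apply) blast
  show "PIdl (\<pi> [^] j) +> c g \<subseteq> (\<lambda>w. w g) ` (filtration R G m j +>\<^bsub>RG\<^esub> c)"
  proof
    fix y assume "y \<in> PIdl (\<pi> [^] j) +> c g"
    then obtain i where i: "i \<in> PIdl (\<pi> [^] j)" "y = i \<oplus> c g" by (auto simp: a_r_coset_def')
    interpret I: ideal "PIdl (\<pi> [^] j)" R by (simp add: cgenideal_ideal)
    \<comment> \<open>Any filtration element with value \<open>i\<close> at \<open>g\<close> would
      do; the constant function is one.\<close>
    have f: "(\<lambda>h\<in>carrier G. i) \<in> filtration R G m j"
      using i(1) I.Icarr by (auto simp: mem_filtration RG_carrier)
    have "y = ((\<lambda>h\<in>carrier G. i) \<oplus>\<^bsub>RG\<^esub> c) g" using i(2) g by (simp add: add_apply)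
    then show "y \<in> (\<lambda>w. w g) ` (filtration R G m j +>\<^bsub>RG\<^esub> c)"
      using f by (auto simp: a_r_coset_def')
  qed
qed

text \<open>The definite description is legitimate because two representatives of the same coset
  differ by some \<open>d\<close> with \<open>\<pi> [^] j \<otimes> d\<close> in
  \<open>PIdl (\<pi> [^] Suc j)\<close>, which puts \<open>d\<close> in \<open>m\<close> by
  \<open>in_m_if_pi_pow_mult\<close>.\<close>

lemma coefficient_iso_coset:
  assumes "j < len" "r \<in> carrier R"
  shows "coefficient_iso R m \<pi> j (PIdl (\<pi> [^] Suc j) +> (\<pi> [^] j \<otimes> r)) = m +> r"
  unfolding coefficient_iso_def ideal_power_eq
proof (rule the_equality)
  show "\<exists>s\<in>carrier R. PIdl (\<pi> [^] Suc j) +> (\<pi> [^] j \<otimes> r) = PIdl (\<pi> [^] Suc j) +> (\<pi> [^] j \<otimes> s)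
      \<and> m +> r = m +> s"
    using assms(2) by blast
next
  fix y
  assume "\<exists>s\<in>carrier R. PIdl (\<pi> [^] Suc j) +> (\<pi> [^] j \<otimes> r) = PIdl (\<pi> [^] Suc j) +> (\<pi> [^] j \<otimes> s)
    \<and> y = m +> s"
  then obtain s where s: "s \<in> carrier R" "y = m +> s"
    "PIdl (\<pi> [^] Suc j) +> (\<pi> [^] j \<otimes> r) = PIdl (\<pi> [^] Suc j) +> (\<pi> [^] j \<otimes> s)"
    by blast
  have "\<pi> [^] j \<otimes> r \<ominus> \<pi> [^] j \<otimes> s \<in> PIdl (\<pi> [^] Suc j)"
    using s assms(2) cgenideal_ideal[of "\<pi> [^] Suc j"] by (simp add: quotient_eq_iff_same_a_r_cos)
  also have "\<pi> [^] j \<otimes> r \<ominus> \<pi> [^] j \<otimes> s = \<pi> [^] j \<otimes> (r \<ominus> s)"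
    using s(1) assms(2) by (simp add: minus_eq r_distr r_minus)
  finally have "r \<ominus> s \<in> m" using s(1) assms by (intro in_m_if_pi_pow_mult) auto
  then show "y = m +> r" using s assms(2) quotient_eq_iff_same_a_r_cos[OF ideal_m] by auto
qed

lemma code_chain_eq:
  assumes "j < len" "D \<subseteq> carrier RG"
  shows "code_chain R G m \<pi> D j = reduction ` {u \<in> carrier RG. \<pi> [^] j \<odot>\<^bsub>RG\<^esub> u \<in> D}"
proof -
  have *: "alpha R G m \<pi> j (filtration R G m (Suc j) +>\<^bsub>RG\<^esub> (\<pi> [^] j \<odot>\<^bsub>RG\<^esub> u)) = reduction u"
    if u: "u \<in> carrier RG" for u
    unfolding alpha_def reduction_def
  proof (rule restrict_ext)
    fix g assume g: "g \<in> carrier G"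
    show "coefficient_iso R m \<pi> j ((\<lambda>w. w g) ` (filtration R G m (Suc j) +>\<^bsub>RG\<^esub> (\<pi> [^] j \<odot>\<^bsub>RG\<^esub> u)))
        = m +> u g"
      using coefficient_iso_coset[OF assms(1) coeff_closed[OF u g]] u g
      by (simp add: coset_coefficient smult_closed smult_apply)
  qed
  have "D \<inter> filtration R G m j = (\<lambda>u. \<pi> [^] j \<odot>\<^bsub>RG\<^esub> u) ` {u \<in> carrier RG. \<pi> [^] j \<odot>\<^bsub>RG\<^esub> u \<in> D}"
    by (auto simp: mem_filtration_smult)
  then show ?thesis unfolding code_chain_def by (auto simp: image_image * intro!: image_cong)
qed

section \<open>The chain of the dual code\<close>

text \<open>This is the hard inclusion: \<open>v\<close> is only orthogonal modulo \<open>m\<close>,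
  and it is corrected within its residue class. The correcting functional is prescribed to vanish on
  \<open>\<pi>^j C\<close> and to agree with the form with \<open>v\<close> on
  \<open>\<pi>^(len-1) RG\<close>.\<close>

lemma lift_to_dual_code:
  assumes C: "group_code R G C" and j: "j < len" and v: "v \<in> carrier RG"
    and orth: "\<And>u. u \<in> carrier RG \<Longrightarrow> \<pi> [^] (len - 1 - j) \<odot>\<^bsub>RG\<^esub> u \<in> C \<Longrightarrow> code_form R G u v \<in> m"
  obtains w where "w \<in> carrier RG" "\<pi> [^] j \<odot>\<^bsub>RG\<^esub> w \<in> dual_code R G C" "reduction w = reduction v"
proof -
  interpret RG: ring RG by (rule ring_RG)
  interpret C: left_ideal C RG using C by (simp add: group_code_def)
  have C_carrier: "c \<in> carrier RG" if "c \<in> C" for c using that by simp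
  have C_smult: "r \<odot>\<^bsub>RG\<^esub> c \<in> C" if "r \<in> carrier R" "c \<in> C" for r c
    using that by (simp add: smult_eq_emb_mult C.l_closed)
  define p q r where "p = \<pi> [^] j" and "q = \<pi> [^] (len - 1)" and "r = \<pi> [^] (len - 1 - j)"
  have [simp]: "p \<in> carrier R" "q \<in> carrier R" "r \<in> carrier R" by (simp_all add: p_def q_def r_def)
  have pq: "q = p \<otimes> r" using j by (simp add: p_def q_def r_def R.nat_pow_mult)
  define x where "x c u = (p \<odot>\<^bsub>RG\<^esub> c) \<oplus>\<^bsub>RG\<^esub> (q \<odot>\<^bsub>RG\<^esub> u)" for c u
  have x_closed: "x c u \<in> carrier RG" if "c \<in> carrier RG" "u \<in> carrier RG" for c u
    using that by (simp add: x_def smult_closed)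
  have x_apply: "x c u g = p \<otimes> c g \<oplus> q \<otimes> u g" if "g \<in> carrier G" for c u g
    using that by (simp add: x_def add_apply smult_apply)
  \<comment> \<open>The graph is parametrized by pairs \<open>c\<close>, \<open>u\<close>; that the
    value does not depend on the chosen pair follows from the kernel condition verified
    last.\<close>
  define F where "F = {(x c u, q \<otimes> code_form R G u v) | c u. c \<in> C \<and> u \<in> carrier RG}"
  have "\<exists>w\<in>carrier G \<rightarrow> carrier R. \<forall>(x, y)\<in>F. y = (\<Oplus>g\<in>carrier G. x g \<otimes> w g)"
  proof (rule functional_extension)
    show "y g \<in> carrier R" if "(y, z) \<in> F" "g \<in> carrier G" for y z g
      using that x_closed coeff_closed by (auto simp: F_def)
    show "z \<in> carrier R" if "(y, z) \<in> F" for y z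
      using that v form_closed by (auto simp: F_def)
    show "(\<lambda>g\<in>carrier G. y g \<oplus> y' g, z \<oplus> z') \<in> F" if F: "(y, z) \<in> F" "(y', z') \<in> F" for y z y' z'
    proof -
      obtain c u c' u' where cu: "c \<in> C" "u \<in> carrier RG" "y = x c u" "z = q \<otimes> code_form R G u v"
        "c' \<in> C" "u' \<in> carrier RG" "y' = x c' u'" "z' = q \<otimes> code_form R G u' v"
        using F by (auto simp: F_def)
      have "y \<oplus>\<^bsub>RG\<^esub> y' = x (c \<oplus>\<^bsub>RG\<^esub> c') (u \<oplus>\<^bsub>RG\<^esub> u')"
      proof (rule carrier_eqI)
        fix g assume g: "g \<in> carrier G"
        then have "c g \<in> carrier R" "u g \<in> carrier R" "c' g \<in> carrier R" "u' g \<in> carrier R"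
          using cu C_carrier coeff_closed by auto
        then show "(y \<oplus>\<^bsub>RG\<^esub> y') g = x (c \<oplus>\<^bsub>RG\<^esub> c') (u \<oplus>\<^bsub>RG\<^esub> u') g"
          using g cu(3,7) by (simp add: x_apply add_apply r_distr a_ac)
      qed (use cu x_closed C_carrier in simp_all)
      then have "(\<lambda>g\<in>carrier G. y g \<oplus> y' g) = x (c \<oplus>\<^bsub>RG\<^esub> c') (u \<oplus>\<^bsub>RG\<^esub> u')"
        by (simp add: group_ring_def)
      moreover have "z \<oplus> z' = q \<otimes> code_form R G (u \<oplus>\<^bsub>RG\<^esub> u') v"
        using cu v by (simp add: form_add_left form_closed r_distr)
      ultimately show ?thesis using cu unfolding F_def by (blast intro: C.a_closed RG.a_closed)
    qed
    show "(\<lambda>g\<in>carrier G. a \<otimes> y g, a \<otimes> z) \<in> F" if a: "a \<in> carrier R" and F: "(y, z) \<in> F" for a y z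
    proof -
      obtain c u where cu: "c \<in> C" "u \<in> carrier RG" "y = x c u" "z = q \<otimes> code_form R G u v"
        using F by (auto simp: F_def)
      have "a \<odot>\<^bsub>RG\<^esub> y = x (a \<odot>\<^bsub>RG\<^esub> c) (a \<odot>\<^bsub>RG\<^esub> u)"
      proof (rule carrier_eqI)
        fix g assume g: "g \<in> carrier G"
        then have "c g \<in> carrier R" "u g \<in> carrier R" using cu C_carrier coeff_closed by auto
        then show "(a \<odot>\<^bsub>RG\<^esub> y) g = x (a \<odot>\<^bsub>RG\<^esub> c) (a \<odot>\<^bsub>RG\<^esub> u) g"
          using g a cu(3) by (simp add: x_apply smult_apply r_distr m_lcomm)
      qed (use cu a x_closed C_carrier in \<open>simp_all add: smult_closed\<close>)
      then have "(\<lambda>g\<in>carrier G. a \<otimes> y g) = x (a \<odot>\<^bsub>RG\<^esub> c) (a \<odot>\<^bsub>RG\<^esub> u)"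
        by (simp add: group_ring_def)
      moreover have "a \<otimes> z = q \<otimes> code_form R G (a \<odot>\<^bsub>RG\<^esub> u) v"
        using cu v a by (simp add: form_smult_left form_closed m_ac)
      ultimately show ?thesis using cu a unfolding F_def by (blast intro: C_smult smult_closed)
    qed
    \<comment> \<open>If \<open>p c + q u = 0\<close>, then \<open>p\<close> kills
      \<open>c + r u\<close>, which is therefore divisible by
      \<open>\<pi> [^] (len - j) = r \<otimes> \<pi>\<close>. Dividing by \<open>r\<close> produces
      a vector to which the orthogonality hypothesis applies.\<close>
    show "z = \<zero>" if F: "(y, z) \<in> F" and y: "\<And>g. g \<in> carrier G \<Longrightarrow> y g = \<zero>" for y z
    proof -
      obtain c u where cu: "c \<in> C" "u \<in> carrier RG" "y = x c u" "z = q \<otimes> code_form R G u v"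
        using F by (auto simp: F_def)
      have "\<exists>s. s \<in> carrier R \<and> c g \<oplus> r \<otimes> u g = \<pi> [^] (len - j) \<otimes> s" if g: "g \<in> carrier G" for g
      proof -
        have "p \<otimes> (c g \<oplus> r \<otimes> u g) = y g"
          using cu g C_carrier by (simp add: x_apply pq coeff_closed r_distr R.m_assoc)
        then have "p \<otimes> (c g \<oplus> r \<otimes> u g) = \<zero>" using y g by simp
        then obtain s where "s \<in> carrier R" "c g \<oplus> r \<otimes> u g = \<pi> [^] (len - j) \<otimes> s"
          using cu g j C_carrier coeff_closed
          by (elim annihilator_pi_pow[rotated 2, of j, folded p_def]) auto
        then show ?thesis by blast
      qed
      then have "\<forall>g\<in>carrier G. \<exists>s. s \<in> carrier R \<and> c g \<oplus> r \<otimes> u g = \<pi> [^] (len - j) \<otimes> s" by blast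
      then obtain s where s: "\<forall>g\<in>carrier G. s g \<in> carrier R
          \<and> c g \<oplus> r \<otimes> u g = \<pi> [^] (len - j) \<otimes> s g"
        by (rule bchoice[THEN exE])
      have lj: "\<pi> [^] (len - j) = r \<otimes> \<pi>" using j by (simp add: r_def Suc_diff_Suc flip: R.nat_pow_Suc)
      define t where "t = restrict s (carrier G)"
      \<comment> \<open>Chosen so that \<open>r u' = c\<close> and \<open>u + u'\<close> is a
        multiple of \<open>\<pi>\<close>: the first puts the form of \<open>u'\<close> with
        \<open>v\<close> in \<open>m\<close>, the second transfers this to \<open>u\<close>.\<close>
      define u' where "u' = (\<lambda>g\<in>carrier G. \<pi> \<otimes> s g \<ominus> u g)"
      have t: "t \<in> carrier RG" and u': "u' \<in> carrier RG"
        using s cu(2) by (auto simp: t_def u'_def RG_carrier coeff_closed PiE_iff)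
      have "r \<odot>\<^bsub>RG\<^esub> u' = c"
      proof (rule carrier_eqI)
        fix g assume g: "g \<in> carrier G"
        then have cl: "s g \<in> carrier R" "u g \<in> carrier R" "c g \<in> carrier R"
          and eq: "c g \<oplus> r \<otimes> u g = r \<otimes> \<pi> \<otimes> s g"
          using s cu C_carrier coeff_closed by (auto simp: lj)
        have "r \<otimes> (\<pi> \<otimes> s g \<ominus> u g) = r \<otimes> \<pi> \<otimes> s g \<ominus> r \<otimes> u g"
          using cl by (simp add: minus_eq r_distr r_minus R.m_assoc)
        also have "\<dots> = c g" using cl unfolding eq[symmetric] by (simp add: minus_eq a_assoc r_neg)
        finally show "(r \<odot>\<^bsub>RG\<^esub> u') g = c g" using g by (simp add: smult_apply u'_def)
      qed (use u' cu C_carrier in \<open>auto intro: smult_closed\<close>)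
      then have m1: "code_form R G u' v \<in> m" using orth[OF u'] cu(1) by (simp add: r_def)
      have "u \<oplus>\<^bsub>RG\<^esub> u' = \<pi> \<odot>\<^bsub>RG\<^esub> t"
      proof (rule carrier_eqI)
        fix g assume g: "g \<in> carrier G"
        then have cl: "s g \<in> carrier R" "u g \<in> carrier R" using s cu coeff_closed by auto
        have "u g \<oplus> (\<pi> \<otimes> s g \<ominus> u g) = \<pi> \<otimes> s g" using cl pi_closed by algebra
        then show "(u \<oplus>\<^bsub>RG\<^esub> u') g = (\<pi> \<odot>\<^bsub>RG\<^esub> t) g"
          using g by (simp add: add_apply smult_apply u'_def t_def)
      qed (use t u' cu in \<open>auto intro: smult_closed\<close>)
      then have sum: "code_form R G u v \<oplus> code_form R G u' v = \<pi> \<otimes> code_form R G t v"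
        using form_add_left[of u u' v] form_smult_left[of \<pi> t v] cu(2) u' t v by simp
      interpret M: ideal m R by (rule ideal_m)
      have "\<pi> \<otimes> code_form R G t v \<in> m"
        using t v form_closed unfolding m_eq by (auto simp: cgenideal_mem_right)
      then have "(code_form R G u v \<oplus> code_form R G u' v) \<oplus> \<ominus> code_form R G u' v \<in> m"
        unfolding sum using m1 by (simp add: M.a_closed M.a_inv_closed)
      then have "code_form R G u v \<in> m"
        using cu(2) u' v by (simp add: form_closed a_assoc r_neg)
      then show ?thesis
        using cu(2,4) v j pi_pow_times_eq_zero_iff[of "code_form R G u v"] by (auto simp: q_def form_closed)
    qed
  qed auto
  then obtain w0 where w0: "w0 \<in> carrier G \<rightarrow> carrier R"
    and "\<forall>(x, y)\<in>F. y = (\<Oplus>g\<in>carrier G. x g \<otimes> w0 g)" ..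
  then have ext: "q \<otimes> code_form R G u v = (\<Oplus>g\<in>carrier G. x c u g \<otimes> w0 g)"
    if "c \<in> C" "u \<in> carrier RG" for c u
  proof -
    have "(x c u, q \<otimes> code_form R G u v) \<in> F" using that by (auto simp: F_def)
    then show ?thesis using \<open>\<forall>(x, y)\<in>F. y = (\<Oplus>g\<in>carrier G. x g \<otimes> w0 g)\<close> by blast
  qed
  define w where "w = restrict w0 (carrier G)"
  have w: "w \<in> carrier RG" using w0 by (auto simp: w_def RG_carrier)
  have ext_form: "q \<otimes> code_form R G u v = p \<otimes> code_form R G c w \<oplus> q \<otimes> code_form R G u w"
    if cu: "c \<in> C" "u \<in> carrier RG" for c u
  proof -
    have "(\<Oplus>g\<in>carrier G. x c u g \<otimes> w0 g) = code_form R G (x c u) w"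
      unfolding code_form_def
      using x_closed[OF C_carrier[OF cu(1)] cu(2)] w w0
      by (intro finsum_cong') (auto simp: w_def coeff_closed funcset_mem[OF w0])
    also have "\<dots> = p \<otimes> code_form R G c w \<oplus> q \<otimes> code_form R G u w"
      using cu w C_carrier by (simp add: x_def form_add_left form_smult_left smult_closed)
    finally show ?thesis unfolding ext[OF cu] .
  qed
  show thesis
  proof (rule that[OF w])
    \<comment> \<open>Taking \<open>u\<close> to be zero leaves only the term of \<open>c\<close>,
      whose prescribed value is zero.\<close>
    have "code_form R G c (p \<odot>\<^bsub>RG\<^esub> w) = \<zero>" if c: "c \<in> C" for c
      using ext_form[OF c RG.zero_closed] c w v C_carrier
      by (simp add: form_zero_left form_smult_right form_closed)
    then show "\<pi> [^] j \<odot>\<^bsub>RG\<^esub> w \<in> dual_code R G C" using w by (simp add: dual_code_def smult_closed flip: p_def)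
    have "w g \<ominus> v g \<in> m" if g: "g \<in> carrier G" for g
    proof -
      have cl: "w g \<in> carrier R" "v g \<in> carrier R" using g w v coeff_closed by auto
      \<comment> \<open>Taking \<open>c\<close> to be zero and \<open>u\<close> to be a group basis
        vector compares the coefficients of \<open>v\<close> and \<open>w\<close> after
        multiplication by \<open>q\<close>, hence modulo \<open>m\<close>.\<close>
      have "q \<otimes> v g = q \<otimes> w g"
        using ext_form[OF C.zero_closed delta_closed[of g]] g v w
        by (simp add: form_delta_left form_zero_left coeff_closed)
      then have "q \<otimes> (w g \<ominus> v g) = \<zero>" using cl by (simp add: minus_eq r_distr r_minus r_neg)
      then show ?thesis
        using cl j pi_pow_times_eq_zero_iff[of "w g \<ominus> v g"] by (auto simp: q_def)
    qed
    then show "reduction w = reduction v" using w v by (simp add: reduction_eq_iff)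
  qed
qed

text \<open>Both sides become images under \<open>reduction\<close> of sets in \<open>RG\<close>.
  One inclusion holds before reduction; for the other, \<open>lift_to_dual_code\<close> replaces
  each vector by a congruent one, so only the images are compared.\<close>

theorem code_chain_dual:
  assumes C: "group_code R G C" and j: "j < len"
  shows "code_chain R G m \<pi> (dual_code R G C) j
    = dual_code (R Quot m) G (code_chain R G m \<pi> C (len - 1 - j))"
proof -
  interpret C: left_ideal C RG using C by (simp add: group_code_def)
  let ?k = "len - 1 - j"
  let ?D = "{u \<in> carrier RG. \<pi> [^] ?k \<odot>\<^bsub>RG\<^esub> u \<in> C}"
  have "code_chain R G m \<pi> (dual_code R G C) j
      = reduction ` {v \<in> carrier RG. \<pi> [^] j \<odot>\<^bsub>RG\<^esub> v \<in> dual_code R G C}" (is "_ = reduction ` ?L")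
    using j by (rule code_chain_eq) (auto simp: dual_code_def)
  also have "\<dots> = reduction ` {v \<in> carrier RG. \<forall>u\<in>?D. code_form R G u v \<in> m}" (is "_ = reduction ` ?R")
  proof
    have "?L \<subseteq> ?R"
    proof (intro subsetI CollectI conjI ballI)
      fix v u assume v: "v \<in> ?L" and u: "u \<in> ?D"
      \<comment> \<open>The exponents \<open>len - 1 - j\<close> and \<open>j\<close> add up to
        \<open>len - 1\<close>, the last exponent with a nonzero power; this is the source of the
        index reversal.\<close>
      have "\<pi> [^] (len - 1) \<otimes> code_form R G u v
          = code_form R G (\<pi> [^] ?k \<odot>\<^bsub>RG\<^esub> u) (\<pi> [^] j \<odot>\<^bsub>RG\<^esub> v)"
        using u v j by (simp add: form_smult_left form_smult_right form_closed smult_closed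
            R.nat_pow_mult flip: R.m_assoc)
      also have "\<dots> = \<zero>" using u v by (simp add: dual_code_def)
      finally show "code_form R G u v \<in> m"
        using u v j pi_pow_times_eq_zero_iff[of "code_form R G u v"] by (auto simp: form_closed)
    qed auto
    then show "reduction ` ?L \<subseteq> reduction ` ?R" by (rule image_mono)
    show "reduction ` ?R \<subseteq> reduction ` ?L"
    proof (rule image_subsetI)
      fix v assume v: "v \<in> ?R"
      obtain w where "w \<in> carrier RG" "\<pi> [^] j \<odot>\<^bsub>RG\<^esub> w \<in> dual_code R G C" "reduction w = reduction v"
        by (rule lift_to_dual_code[OF C j, of v]) (use v in auto)
      then show "reduction v \<in> reduction ` ?L" by (intro image_eqI[of _ _ w]) auto
    qed
  qed
  also have "\<dots> = dual_code (R Quot m) G (reduction ` ?D)"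
    by (rule dual_code_reduction[symmetric]) auto
  also have "reduction ` ?D = code_chain R G m \<pi> C ?k"
    using j C.a_subset by (intro code_chain_eq[symmetric]) auto
  finally show ?thesis .
qed

text \<open>Multiplying by \<open>\<pi>\<close> keeps a vector in the code and raises the exponent
  by one, so the same \<open>u\<close> witnesses membership in the next step.\<close>

lemma code_chain_mono:
  assumes C: "group_code R G C" and i: "Suc i < len"
  shows "code_chain R G m \<pi> C i \<subseteq> code_chain R G m \<pi> C (Suc i)"
proof -
  interpret C: left_ideal C RG using C by (simp add: group_code_def)
  have "\<pi> [^] Suc i \<odot>\<^bsub>RG\<^esub> u \<in> C" if u: "u \<in> carrier RG" "\<pi> [^] i \<odot>\<^bsub>RG\<^esub> u \<in> C" for u
  proof -
    have "\<pi> [^] Suc i \<odot>\<^bsub>RG\<^esub> u = emb \<pi> \<otimes>\<^bsub>RG\<^esub> (\<pi> [^] i \<odot>\<^bsub>RG\<^esub> u)"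
      unfolding smult_eq_emb_mult[OF pi_closed smult_closed[OF R.nat_pow_closed[OF pi_closed] u(1)], symmetric]
      using u(1) by (intro carrier_eqI) (auto simp: smult_apply coeff_closed m_ac intro!: smult_closed)
    then show ?thesis using u(2) by (simp add: C.l_closed)
  qed
  then show ?thesis using i C.a_subset by (auto simp: code_chain_eq simp del: R.nat_pow_Suc)
qed

end

lemma dual_code_antimono: "C \<subseteq> D \<Longrightarrow> dual_code A G D \<subseteq> dual_code A G C"
  by (auto simp: dual_code_def)

theorem lemma2p9:
  fixes R :: "('a, 'b) ring_scheme" and G :: "('g, 'c) monoid_scheme"
    and m :: "'a set" and \<pi> :: 'a and p l :: nat and C :: "('g \<Rightarrow> 'a) set"
  assumes "artinian_chain_ring R"
    and "maximalideal m R" and "\<pi> \<in> carrier R" and "m = PIdl\<^bsub>R\<^esub> \<pi>"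
    and "finite (carrier (R Quot m))" and "has_characteristic (R Quot m) p"
    and "l = chain_ring_length R m"
    and "group G" and "finite (carrier G)"
    and "group_code R G C" and "relative_projective R G C"
  shows "(\<forall>j<l. code_chain R G m \<pi> (dual_code R G C) j =
            dual_code (R Quot m) G (code_chain R G m \<pi> C (l - 1 - j)))
    \<and> (\<forall>i. Suc i < l \<longrightarrow>
            dual_code (R Quot m) G (code_chain R G m \<pi> C (Suc i))
              \<subseteq> dual_code (R Quot m) G (code_chain R G m \<pi> C i))"
proof -
  interpret R: artinian_chain_ring R by fact
  interpret chain_group_ring R m \<pi> G
  proof (intro chain_group_ring.intro uniformized_chain_ring.intro uniformized_chain_ring_axioms.intro
      group_ring_setup.intro group_ring_setup_axioms.intro)
  qed (use assms in \<open>auto intro: R.is_cring\<close>)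
  \<comment> \<open>The inclusions among the duals arise from the ascending chain of
    \<open>C\<close>, reversed by taking duals.\<close>
  show ?thesis
    using assms(7) code_chain_dual[OF assms(10)] code_chain_mono[OF assms(10)]
    by (simp add: dual_code_antimono)
qed

end
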